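(* Let $d\ge 2$, let $\varphi$ be an even Borel probability measure on $\mathbb{S}^{d-1}$ that is not concentrated on a great subsphere, and let $K\subset\mathbb{R}^d$ be a convex body. Let the Poisson hyperplane processes $X_\gamma=\xi([0,\gamma]\times\cdot)$, $\gamma\ge 1$, be defined on a common probability space as described in the context, and let $Z_K^{(\gamma)}$ denote the $K$-cell of $X_\gamma$. Then the condition $$\operatorname{supp} S_{d-1}(K,\cdot)\subset\operatorname{supp}\varphi$$ is necessary and sufficient in order that $$\lim_{\gamma\to\infty}\delta(K,Z_K^{(\gamma)})=0\quad\text{almost surely}.$$
   Context: A convex body is a compact convex subset of $\mathbb{R}^d$ with nonempty interior. $\mathbb{S}^{d-1}$ is the unit sphere and $\delta$ the Hausdorff metric (Euclidean norm). $S_{d-1}(K,\cdot)$ is the surface area measure of $K$ on $\mathbb{S}^{d-1}$: $S_{d-1}(K,\omega)$ is the $(d-1)$-dimensional Hausdorff measure of the set of boundary points of $K$ having an outer unit normal vector in the Borel set $\omega$. $\operatorname{supp}$ denotes the support of a measure. Let $\mathcal{H}^d$ be the space of hyperplanes in $\mathbb{R}^d$, $H(u,t)=\{x\in\mathbb{R}^d:\langle x,u\rangle=t\}$, and for $\gamma>0$ let $$\Theta_\gamma(A)=2\gamma\int_{\mathbb{S}^{d-1}}\int_0^\infty \mathbf{1}_A(H(u,t))\,dt\,\varphi(du),\qquad A\in\mathcal{B}(\mathcal{H}^d).$$ Let $\xi$ be a Poisson process on $[0,\infty)\times\mathcal{H}^d$ with intensity measure $\lambda\otimes\Theta_1$,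 where $\lambda$ is Lebesgue measure on $[0,\infty)$. Then $X_\gamma:=\xi([0,\gamma]\times\cdot)$ is a stationary Poisson hyperplane process with intensity $\gamma$, directional distribution $\varphi$ and intensity measure $\Theta_\gamma$; it is identified with its support, a locally finite random set of hyperplanes. For a hyperplane $H$ with $H\cap K=\emptyset$, let $H^-_K$ be the closed halfspace bounded by $H$ that contains $K$. The $K$-cell of $X_\gamma$ is the (almost surely bounded) random polytope $Z_K^{(\gamma)}=\bigcap_{H\in X_\gamma,\,H\cap K=\emptyset}H^-_K$. *)

theory Defs
  imports "HOL-Probability.Probability"
begin

section \<open>Convex bodies and the Hausdorff metric\<close>

definition convex_body :: "'a::euclidean_space set \<Rightarrow> bool" where
  "convex_body K \<longleftrightarrow> compact K \<and> convex K \<and> interior K \<noteq> {}"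

text \<open>The extended nonnegative reals as codomain make the distance to an unbounded set infinite;
  a real-valued \<^const>\<open>Sup\<close> would be unspecified there. On nonempty compact sets this is the
  usual Hausdorff metric. (\<^const>\<open>infdist\<close> is 0 for an empty second argument.)\<close>

definition hausdorff_dist :: "'a::metric_space set \<Rightarrow> 'a set \<Rightarrow> ennreal" where
  "hausdorff_dist A B =
     max (SUP x\<in>A. ennreal (infdist x B)) (SUP y\<in>B. ennreal (infdist y A))"


section \<open>Hausdorff measure and surface area measure\<close>

text \<open>The normalisation makes the k-dimensional Hausdorff measure on k-dimensional Euclidean space
  equal to Lebesgue measure. Covering sets must be required to be bounded since
  \<^const>\<open>diameter\<close> is unspecified on unbounded sets.\<close>

definition hausdorff_weight :: "nat \<Rightarrow> 'a::metric_space set \<Rightarrow> ennreal" where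
  "hausdorff_weight k U =
     (if U = {} then 0 else ennreal (unit_ball_vol (real k) * (diameter U / 2) ^ k))"

definition hausdorff_premeasure :: "nat \<Rightarrow> real \<Rightarrow> 'a::metric_space set \<Rightarrow> ennreal" where
  "hausdorff_premeasure k \<epsilon> A =
     (INF U \<in> {U :: nat \<Rightarrow> 'a set. A \<subseteq> (\<Union>i. U i) \<and> (\<forall>i. bounded (U i) \<and> diameter (U i) \<le> \<epsilon>)}.
        \<Sum>i. hausdorff_weight k (U i))"

definition hausdorff_measure :: "nat \<Rightarrow> 'a::metric_space set \<Rightarrow> ennreal" where
  "hausdorff_measure k A = (SUP \<epsilon>\<in>{0<..}. hausdorff_premeasure k \<epsilon> A)"

definition outer_unit_normal :: "'a::euclidean_space set \<Rightarrow> 'a \<Rightarrow> 'a \<Rightarrow> bool" where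
  "outer_unit_normal K x u \<longleftrightarrow> norm u = 1 \<and> (\<forall>y\<in>K. y \<bullet> u \<le> x \<bullet> u)"

text \<open>Given as a set function, which for a convex body is a measure on the Borel sets of the
  sphere. Bundling it by \<^const>\<open>measure_of\<close> would yield the zero measure by default for arguments
  where countable additivity fails.\<close>

definition surface_area_measure :: "'a::euclidean_space set \<Rightarrow> 'a set \<Rightarrow> ennreal" where
  "surface_area_measure K \<omega> =
     hausdorff_measure (DIM('a) - 1) {x \<in> frontier K. \<exists>u\<in>\<omega>. outer_unit_normal K x u}"

definition support :: "'b topology \<Rightarrow> ('b set \<Rightarrow> ennreal) \<Rightarrow> 'b set" where
  "support T \<mu> = {x \<in> topspace T. \<forall>U. openin T U \<and> x \<in> U \<longrightarrow> \<mu> U > 0}"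


section \<open>The space of hyperplanes\<close>

definition hyperplane :: "'a::euclidean_space \<Rightarrow> real \<Rightarrow> 'a set" where
  "hyperplane u t = {x. x \<bullet> u = t}"

definition hyperplanes :: "'a::euclidean_space set set" where
  "hyperplanes = {hyperplane u t | u t. norm u = 1}"

text \<open>The quotient topology of the two-to-one map \<open>(u, t) \<mapsto> H(u, t)\<close> on the product of the unit
  sphere and the reals.\<close>

definition hyperplane_topology :: "'a::euclidean_space set topology" where
  "hyperplane_topology = topology (\<lambda>U. U \<subseteq> hyperplanes \<and>
     openin (top_of_set (sphere 0 1 \<times> UNIV)) {(u, t). norm u = 1 \<and> hyperplane u t \<in> U})"

definition hyperplane_borel :: "'a::euclidean_space set measure" where
  "hyperplane_borel = sigma hyperplanes {U. openin hyperplane_topology U}"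

lemma openin_hyperplane_topology:
  "openin hyperplane_topology U \<longleftrightarrow> U \<subseteq> hyperplanes \<and>
     openin (top_of_set (sphere 0 1 \<times> UNIV)) {(u, t). norm u = 1 \<and> hyperplane u t \<in> U}"
proof -
  let ?O = "openin (top_of_set (sphere (0::'a) 1 \<times> (UNIV :: real set)))"
  let ?P = "\<lambda>U. {(u::'a, t). norm u = 1 \<and> hyperplane u t \<in> U}"
  have 1: "?P (S \<inter> T) = ?P S \<inter> ?P T" for S T by auto
  have 2: "?P (\<Union>\<K>) = \<Union>(?P ` \<K>)" for \<K> by auto
  have "istopology (\<lambda>U. U \<subseteq> hyperplanes \<and> ?O (?P U))"
    unfolding istopology_def
  proof (intro conjI allI impI)
    fix S T assume "S \<subseteq> hyperplanes \<and> ?O (?P S)" "T \<subseteq> hyperplanes \<and> ?O (?P T)"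
    then show "?O (?P (S \<inter> T))" "S \<inter> T \<subseteq> hyperplanes"
      unfolding 1 by blast+
  next
    fix \<K> assume "\<forall>K\<in>\<K>. K \<subseteq> hyperplanes \<and> ?O (?P K)"
    then show "?O (?P (\<Union>\<K>))" "\<Union>\<K> \<subseteq> hyperplanes"
      unfolding 2 by blast+
  qed
  then show ?thesis
    unfolding hyperplane_topology_def by (simp add: topology_inverse')
qed

lemma topspace_hyperplane_topology: "topspace hyperplane_topology = hyperplanes"
proof -
  have "{(u::'a, t). norm u = 1 \<and> hyperplane u t \<in> hyperplanes} = sphere 0 1 \<times> UNIV"
    by (auto simp: hyperplanes_def)
  then have "openin hyperplane_topology (hyperplanes :: 'a set set)"
    by (simp add: openin_hyperplane_topology)
  then show ?thesis
    by (metis openin_hyperplane_topology openin_subset openin_topspace subset_antisym)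
qed

lemma space_hyperplane_borel [simp]: "space hyperplane_borel = hyperplanes"
  by (auto simp: hyperplane_borel_def openin_hyperplane_topology intro!: space_measure_of)

lemma measurable_hyperplane:
  "(\<lambda>(u, t). hyperplane u t) \<in>
     measurable (restrict_space borel (sphere 0 1) \<Otimes>\<^sub>M borel) hyperplane_borel"
  unfolding hyperplane_borel_def
proof (rule measurable_measure_of)
  show "{U. openin hyperplane_topology U} \<subseteq> Pow hyperplanes"
    by (auto simp: openin_hyperplane_topology)
  show "(\<lambda>(u::'a, t). hyperplane u t) \<in>
      space (restrict_space borel (sphere 0 1) \<Otimes>\<^sub>M borel) \<rightarrow> hyperplanes"
    by (auto simp: space_pair_measure space_restrict_space hyperplanes_def)
  fix U :: "'a set set" assume "U \<in> {U. openin hyperplane_topology U}"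
  then obtain W where W: "open W"
      "{(u::'a, t). norm u = 1 \<and> hyperplane u t \<in> U} = sphere 0 1 \<times> UNIV \<inter> W"
    by (auto simp: openin_hyperplane_topology openin_open)
  let ?N = "restrict_space borel (sphere 0 1) \<Otimes>\<^sub>M borel :: ('a \<times> real) measure"
  have "fst \<in> borel_measurable ?N"
    using measurable_fst[of "restrict_space borel (sphere (0::'a) 1)" "borel :: real measure"]
    by (simp add: measurable_restrict_space2_iff)
  then have "(\<lambda>p. (fst p, snd p)) \<in> measurable ?N (borel \<Otimes>\<^sub>M borel)"
    by measurable
  then have "(\<lambda>p. p) \<in> measurable ?N borel"
    by (simp add: borel_prod)
  then have "(\<lambda>p. p) -` W \<inter> space ?N \<in> sets ?N"
    by (rule measurable_sets) (use W in auto)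
  moreover have "(\<lambda>(u::'a, t). hyperplane u t) -` U \<inter> space ?N = (\<lambda>p. p) -` W \<inter> space ?N"
    using W(2) by (auto simp: space_pair_measure space_restrict_space set_eq_iff)
  ultimately show "(\<lambda>(u::'a, t). hyperplane u t) -` U \<inter> space ?N \<in> sets ?N"
    by simp
qed


section \<open>Directional distributions and hyperplane measures\<close>

definition even_measure :: "'a::real_vector measure \<Rightarrow> bool" where
  "even_measure \<phi> \<longleftrightarrow> (\<forall>A\<in>sets \<phi>. emeasure \<phi> (uminus ` A) = emeasure \<phi> A)"

definition directional_distribution :: "'a::euclidean_space measure \<Rightarrow> bool" where
  "directional_distribution \<phi> \<longleftrightarrow>
     sets \<phi> = sets (restrict_space borel (sphere 0 1)) \<and> prob_space \<phi> \<and> even_measure \<phi> \<and>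
     (\<forall>v. norm v = 1 \<longrightarrow> measure \<phi> {u \<in> sphere 0 1. u \<bullet> v = 0} \<noteq> 1)"

definition hyperplane_measure :: "'a::euclidean_space measure \<Rightarrow> real \<Rightarrow> 'a set measure" where
  "hyperplane_measure \<phi> \<gamma> = measure_of hyperplanes (sets hyperplane_borel)
     (\<lambda>A. ennreal (2 * \<gamma>) *
        (\<integral>\<^sup>+u. (\<integral>\<^sup>+t\<in>{0..}. indicator A (hyperplane u t) \<partial>lborel) \<partial>\<phi>))"

lemma sets_hyperplane_measure [simp]: "sets (hyperplane_measure \<phi> \<gamma>) = sets hyperplane_borel"
  unfolding hyperplane_measure_def space_hyperplane_borel[symmetric]
  by (rule sets.sets_measure_of_eq)

lemma emeasure_hyperplane_measure:
  assumes \<phi>: "sets \<phi> = sets (restrict_space borel (sphere 0 1))"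
    and A: "A \<in> sets hyperplane_borel"
  shows "emeasure (hyperplane_measure \<phi> \<gamma>) A =
    ennreal (2 * \<gamma>) * (\<integral>\<^sup>+u. (\<integral>\<^sup>+t\<in>{0..}. indicator A (hyperplane u t) \<partial>lborel) \<partial>\<phi>)"
proof -
  let ?f = "\<lambda>A. ennreal (2 * \<gamma>) *
    (\<integral>\<^sup>+u. (\<integral>\<^sup>+t\<in>{0..}. indicator A (hyperplane u t) \<partial>lborel) \<partial>\<phi>)"
  have s: "sets (\<phi> \<Otimes>\<^sub>M lborel) = sets (restrict_space borel (sphere (0::'a) 1) \<Otimes>\<^sub>M (borel::real measure))"
    by (intro sets_pair_measure_cong \<phi>) simp
  have m: "(\<lambda>(u, t). hyperplane u t) \<in> measurable (\<phi> \<Otimes>\<^sub>M lborel) hyperplane_borel"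
    using measurable_hyperplane unfolding measurable_cong_sets[OF s refl] .
  have mA: "(\<lambda>(u, t). indicator A (hyperplane u t) * indicator {0..} t :: ennreal)
      \<in> borel_measurable (\<phi> \<Otimes>\<^sub>M lborel)" if "A \<in> sets hyperplane_borel" for A
  proof -
    have "(\<lambda>p. indicator A ((\<lambda>(u, t). hyperplane u t) p) :: ennreal)
        \<in> borel_measurable (\<phi> \<Otimes>\<^sub>M lborel)"
      using measurable_compose[OF m borel_measurable_indicator[OF that]] .
    moreover have "(\<lambda>p. indicator {0::real..} (snd p) :: ennreal) \<in> borel_measurable (\<phi> \<Otimes>\<^sub>M lborel)"
      by (rule measurable_compose[OF measurable_snd]) simp
    ultimately have "(\<lambda>p. indicator A ((\<lambda>(u, t). hyperplane u t) p) * indicator {0..} (snd p) :: ennreal)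
        \<in> borel_measurable (\<phi> \<Otimes>\<^sub>M lborel)"
      by (rule borel_measurable_times_ennreal)
    then show ?thesis
      by (simp only: case_prod_unfold)
  qed
  show ?thesis
    unfolding hyperplane_measure_def
  proof (rule emeasure_measure_of_sigma)
    show "sigma_algebra hyperplanes (sets (hyperplane_borel :: 'a set measure))"
      using sets.sigma_algebra_axioms[of "hyperplane_borel :: 'a set measure"] by simp
    show "positive (sets hyperplane_borel) ?f"
      by (simp add: positive_def)
    show "countably_additive (sets hyperplane_borel) ?f"
    proof (rule countably_additiveI)
      fix B :: "nat \<Rightarrow> 'a set set"
      assume B: "range B \<subseteq> sets hyperplane_borel" "disjoint_family B"
      then have Bi: "B i \<in> sets hyperplane_borel" for i by auto
      have "(\<Sum>i. ?f (B i)) = ennreal (2 * \<gamma>) *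
          (\<Sum>i. \<integral>\<^sup>+u. (\<integral>\<^sup>+t\<in>{0..}. indicator (B i) (hyperplane u t) \<partial>lborel) \<partial>\<phi>)"
        by simp
      also have "(\<Sum>i. \<integral>\<^sup>+u. (\<integral>\<^sup>+t\<in>{0..}. indicator (B i) (hyperplane u t) \<partial>lborel) \<partial>\<phi>) =
          (\<integral>\<^sup>+u. (\<Sum>i. \<integral>\<^sup>+t\<in>{0..}. indicator (B i) (hyperplane u t) \<partial>lborel) \<partial>\<phi>)"
        using lborel.borel_measurable_nn_integral_fst[OF mA[OF Bi]]
        by (intro nn_integral_suminf[symmetric]) (simp only: case_prod_conv)
      also have "\<dots> = (\<integral>\<^sup>+u. (\<integral>\<^sup>+t\<in>{0..}. indicator (\<Union>i. B i) (hyperplane u t) \<partial>lborel) \<partial>\<phi>)"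
      proof (rule nn_integral_cong)
        fix u assume u: "u \<in> space \<phi>"
        have "(\<Sum>i. \<integral>\<^sup>+t\<in>{0..}. indicator (B i) (hyperplane u t) \<partial>lborel) =
            (\<integral>\<^sup>+t. (\<Sum>i. indicator (B i) (hyperplane u t) * indicator {0..} t) \<partial>lborel)"
          using measurable_Pair2[OF mA[OF Bi] u]
          by (intro nn_integral_suminf[symmetric]) (simp only: case_prod_conv)
        also have "\<dots> = (\<integral>\<^sup>+t\<in>{0..}. indicator (\<Union>i. B i) (hyperplane u t) \<partial>lborel)"
          by (intro nn_integral_cong) (simp only: ennreal_suminf_multc suminf_indicator[OF B(2)])
        finally show "(\<Sum>i. \<integral>\<^sup>+t\<in>{0..}. indicator (B i) (hyperplane u t) \<partial>lborel) =
            (\<integral>\<^sup>+t\<in>{0..}. indicator (\<Union>i. B i) (hyperplane u t) \<partial>lborel)" .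
      qed
      finally show "(\<Sum>i. ?f (B i)) = ?f (\<Union>i. B i)" .
    qed
  qed (rule A)
qed


section \<open>Poisson processes\<close>

text \<open>A point process is a random locally finite counting measure. Its \<open>\<sigma>\<close>-algebra is that of
  the intensity measure \<open>\<Lambda>\<close>, to be understood as the Borel \<open>\<sigma>\<close>-algebra of the topology \<open>T\<close>.
  The Poisson probabilities are written out because \<^const>\<open>poisson_pmf\<close> is only meaningful for a
  positive rate, whereas \<open>\<Lambda> B = 0\<close> is allowed here.\<close>

definition locally_finite_counting :: "'b topology \<Rightarrow> 'b measure \<Rightarrow> bool" where
  "locally_finite_counting T \<mu> \<longleftrightarrow>
     (\<forall>B\<in>sets \<mu>. emeasure \<mu> B \<in> insert \<infinity> (range of_nat)) \<and>
     (\<forall>C. compactin T C \<longrightarrow> emeasure \<mu> C < \<infinity>)"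

definition point_process ::
    "'w measure \<Rightarrow> 'b topology \<Rightarrow> 'b measure \<Rightarrow> ('w \<Rightarrow> 'b measure) \<Rightarrow> bool" where
  "point_process M T N \<xi> \<longleftrightarrow>
     (\<forall>\<omega>\<in>space M. sets (\<xi> \<omega>) = sets N \<and> locally_finite_counting T (\<xi> \<omega>)) \<and>
     (\<forall>B\<in>sets N. (\<lambda>\<omega>. emeasure (\<xi> \<omega>) B) \<in> borel_measurable M)"

definition poisson_process ::
    "'w measure \<Rightarrow> 'b topology \<Rightarrow> 'b measure \<Rightarrow> ('w \<Rightarrow> 'b measure) \<Rightarrow> bool" where
  "poisson_process M T \<Lambda> \<xi> \<longleftrightarrow>
     point_process M T \<Lambda> \<xi> \<and>
     (\<forall>B\<in>sets \<Lambda>. emeasure \<Lambda> B < \<infinity> \<longrightarrow>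
        (\<forall>k. measure M {\<omega> \<in> space M. emeasure (\<xi> \<omega>) B = of_nat k} =
             measure \<Lambda> B ^ k / fact k * exp (- measure \<Lambda> B))) \<and>
     (\<forall>n. \<forall>B :: nat \<Rightarrow> 'b set. (\<forall>i<n. B i \<in> sets \<Lambda>) \<and> disjoint_family_on B {..<n} \<longrightarrow>
        prob_space.indep_vars M (\<lambda>_. borel) (\<lambda>i \<omega>. emeasure (\<xi> \<omega>) (B i)) {..<n})"

text \<open>Borel and product \<open>\<sigma>\<close>-algebra agree here, both factors being second countable.\<close>

definition hyperplane_driving_process ::
    "'w measure \<Rightarrow> 'a::euclidean_space measure \<Rightarrow> ('w \<Rightarrow> (real \<times> 'a set) measure) \<Rightarrow> bool" where
  "hyperplane_driving_process M \<phi> \<xi> \<longleftrightarrow>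
     poisson_process M (prod_topology (top_of_set {0..}) hyperplane_topology)
       (restrict_space lborel {0..} \<Otimes>\<^sub>M hyperplane_measure \<phi> 1) \<xi>"

definition hyperplane_process ::
    "('w \<Rightarrow> (real \<times> 'a::euclidean_space set) measure) \<Rightarrow> real \<Rightarrow> 'w \<Rightarrow> 'a set set \<Rightarrow> ennreal" where
  "hyperplane_process \<xi> \<gamma> \<omega> = (\<lambda>A. emeasure (\<xi> \<omega>) ({0..\<gamma>} \<times> A))"


section \<open>The K-cell\<close>

definition closed_halfspace_bounded_by :: "'a::euclidean_space set \<Rightarrow> 'a set \<Rightarrow> bool" where
  "closed_halfspace_bounded_by H h \<longleftrightarrow>
     (\<exists>u t. norm u = 1 \<and> H = hyperplane u t \<and> h = {x. x \<bullet> u \<le> t})"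

text \<open>Each hyperplane bounds two closed halfspaces, given by \<open>(u, t)\<close> and \<open>(-u, -t)\<close>; exactly one
  of them contains \<open>K\<close> if \<open>K\<close> is nonempty, convex and disjoint from the hyperplane.\<close>

definition cell_of :: "'a::euclidean_space set set \<Rightarrow> 'a set \<Rightarrow> 'a set" where
  "cell_of X K = \<Inter>{h. \<exists>H\<in>X. H \<inter> K = {} \<and> closed_halfspace_bounded_by H h \<and> K \<subseteq> h}"

definition K_cell ::
    "('w \<Rightarrow> (real \<times> 'a::euclidean_space set) measure) \<Rightarrow> 'a set \<Rightarrow> real \<Rightarrow> 'w \<Rightarrow> 'a set" where
  "K_cell \<xi> K \<gamma> \<omega> = cell_of (support hyperplane_topology (hyperplane_process \<xi> \<gamma> \<omega>)) K"

end

theory Submission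
  imports Defs
begin

text \<open>Let \<open>K_C\<close> be the intersection of the supporting halfspaces of \<open>K\<close> with outer normals in \<open>C\<close>.
  The K-cells decrease to \<open>K_C\<close> with \<open>C = supp \<phi>\<close>, because a Poisson process of growing intensity
  eventually hits every open set of hyperplanes of positive measure and never hits one of measure
  zero. So the question is when \<open>K_C = K\<close>.

  If \<open>C\<close> contains the support of the surface area measure but \<open>K_C\<close> exceeds \<open>K\<close>, then no boundary
  point of \<open>K\<close> interior to \<open>K_C\<close> has a normal in \<open>C\<close>, so these points form a Hausdorff null set; but
  the cone over them contains a nonempty open set, a contradiction.

  Conversely, if \<open>K_C = K\<close> where \<open>C\<close> is the complement of an open set \<open>U\<close> of normals, every boundary
  point has a normal in \<open>C\<close>. So a point that also has a normal in \<open>U\<close> is singular, and the singular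
  points form a Hausdorff null set. Hence \<open>U\<close> has surface area measure zero.\<close>


section \<open>Hausdorff null sets\<close>

text \<open>The surface area measure is a bare set function here and enters through the open sets on
  which it vanishes, so the geometry is phrased with Hausdorff null sets alone. The complement of a
  support is a union of possibly uncountably many open null sets; the Lindelof property, on the
  sphere and on the space of hyperplanes, makes such unions countable.

  The probabilistic obstacle is that the exceptional event on which a point is not cut off depends
  on the point. A whole neighbourhood whose radius does not depend on \<open>\<omega>\<close> is
  therefore cut off at once. Each cell is convex and contains \<open>K\<close>, so it stays within
  distance \<open>\<epsilon>\<close> of \<open>K\<close> if it misses the level set of points at
  distance exactly \<open>\<epsilon>\<close>. This set is compact, which leaves finitely many events
  for each \<open>\<epsilon>\<close>. Monotonicity of the process in \<open>\<gamma>\<close> reduces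
  real intensities to integers.

  For necessity, \<open>U\<close> is a neighbourhood of one direction outside supp
  \<open>\<phi>\<close>. Its complement in the sphere is compact, so limits of separating normals
  remain in it.\<close>

lemma ennreal_pos_real_below:
  fixes \<eta> :: ennreal
  assumes "\<eta> > 0"
  obtains e :: real where "e > 0" "ennreal e < \<eta>"
proof -
  obtain c where c: "0 < c" "c < \<eta>" using assms dense by blast
  then have "c \<noteq> top" by auto
  then obtain e where e: "c = ennreal e" "e \<ge> 0"
    by (cases c rule: ennreal_cases) auto
  show ?thesis
    using c e by (intro that[of e]) simp_all
qed

lemma hausdorff_measure_eq_0_iff:
  "hausdorff_measure k A = 0 \<longleftrightarrow>
     (\<forall>\<epsilon>>0. \<forall>\<eta>>0. \<exists>U. A \<subseteq> (\<Union>i. U i) \<and> (\<forall>i::nat. bounded (U i) \<and> diameter (U i) \<le> \<epsilon>) \<and>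
        (\<Sum>i. hausdorff_weight k (U i)) < \<eta>)"
proof -
  have "hausdorff_premeasure k \<epsilon> A = 0 \<longleftrightarrow> (\<forall>\<eta>>0. hausdorff_premeasure k \<epsilon> A < \<eta>)" for \<epsilon>
  proof
    assume "\<forall>\<eta>>0. hausdorff_premeasure k \<epsilon> A < \<eta>"
    then have "\<not> 0 < hausdorff_premeasure k \<epsilon> A" by (metis less_irrefl)
    then show "hausdorff_premeasure k \<epsilon> A = 0" by simp
  qed simp
  then have "hausdorff_measure k A = 0 \<longleftrightarrow> (\<forall>\<epsilon>>0. \<forall>\<eta>>0. hausdorff_premeasure k \<epsilon> A < \<eta>)"
    unfolding hausdorff_measure_def bot_ennreal[symmetric] SUP_bot_conv by (simp only: greaterThan_iff Ball_def)
  then show ?thesis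
    unfolding hausdorff_premeasure_def INF_less_iff by (simp only: mem_Collect_eq Bex_def conj_assoc)
qed

lemma hausdorff_measure_0_subset:
  assumes "hausdorff_measure k B = 0" "A \<subseteq> B"
  shows "hausdorff_measure k A = 0"
  using assms unfolding hausdorff_measure_eq_0_iff by (meson subset_trans)

text \<open>The n-th set is covered at cost below e / 2^(n+1), and the double sequence of covering
  sets is renumbered by \<open>prod_decode\<close>.\<close>

lemma hausdorff_measure_0_UN:
  assumes null: "\<And>i. i \<in> I \<Longrightarrow> hausdorff_measure k (A i) = 0" and "countable I"
  shows "hausdorff_measure k (\<Union>i\<in>I. A i) = 0"
proof (cases "I = {}")
  case True
  have "hausdorff_measure k {} = 0"
    unfolding hausdorff_measure_eq_0_iff
    by (intro allI impI exI[of _ "\<lambda>_. {}"]) (auto simp: hausdorff_weight_def)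
  then show ?thesis
    using True by simp
next
  case False
  define B where "B n = A (from_nat_into I n)" for n
  have B: "hausdorff_measure k (B n) = 0" for n
    unfolding B_def using False by (intro null from_nat_into)
  have UB: "(\<Union>i\<in>I. A i) = (\<Union>n. B n)"
    using arg_cong[OF range_from_nat_into[OF False \<open>countable I\<close>], of "\<lambda>J. \<Union>i\<in>J. A i"]
    by (simp add: B_def)
  show ?thesis
    unfolding UB hausdorff_measure_eq_0_iff
  proof (intro allI impI)
    fix \<epsilon> :: real and \<eta> :: ennreal assume "\<epsilon> > 0" "\<eta> > 0"
    obtain e :: real where e: "e > 0" "ennreal e < \<eta>"
      using \<open>\<eta> > 0\<close> by (rule ennreal_pos_real_below)
    have "\<exists>U. B n \<subseteq> (\<Union>i. U i) \<and> (\<forall>i::nat. bounded (U i) \<and> diameter (U i) \<le> \<epsilon>) \<and>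
        (\<Sum>i. hausdorff_weight k (U i)) < ennreal (e * (1/2) ^ Suc n)" for n
    proof -
      have "ennreal (e * (1/2) ^ Suc n) > 0" using e by simp
      then show ?thesis
        using B[of n] \<open>\<epsilon> > 0\<close> unfolding hausdorff_measure_eq_0_iff by blast
    qed
    then obtain U where U: "\<And>n. B n \<subseteq> (\<Union>i. U n i)"
        "\<And>n i. bounded (U n i) \<and> diameter (U n i) \<le> \<epsilon>"
        "\<And>n. (\<Sum>i. hausdorff_weight k (U n i)) < ennreal (e * (1/2) ^ Suc n)"
      by metis
    define V where "V j = case_prod U (prod_decode j)" for j
    have "(\<Sum>j. hausdorff_weight k (V j)) = (\<Sum>n. \<Sum>i. hausdorff_weight k (U n i))"
      unfolding V_def
      by (rule suminf_ennreal_2dimen[where f = "\<lambda>p. hausdorff_weight k (case_prod U p)"]) simp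
    also have "\<dots> \<le> (\<Sum>n. ennreal (e * (1/2) ^ Suc n))"
      by (intro suminf_le less_imp_le[OF U(3)]) auto
    also have "\<dots> = ennreal (\<Sum>n. e * (1/2) ^ Suc n)"
      using e by (intro suminf_ennreal2) (auto intro!: summable_mult)
    also have "(\<Sum>n. e * (1/2) ^ Suc n) = e"
      using sums_mult[OF power_half_series, of e] by (simp add: sums_iff)
    also have "\<dots> < \<eta>" by fact
    finally have "(\<Sum>j. hausdorff_weight k (V j)) < \<eta>" .
    moreover have "(\<Union>n. B n) \<subseteq> (\<Union>j. V j)"
    proof
      fix x assume "x \<in> (\<Union>n. B n)"
      then obtain n i where "x \<in> U n i" using U(1) by blast
      then have "x \<in> V (prod_encode (n, i))" by (simp add: V_def)
      then show "x \<in> (\<Union>j. V j)" by blast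
    qed
    moreover have "bounded (V j) \<and> diameter (V j) \<le> \<epsilon>" for j
      using U(2) by (simp add: V_def case_prod_unfold)
    ultimately show "\<exists>V. (\<Union>n. B n) \<subseteq> (\<Union>i. V i) \<and> (\<forall>i::nat. bounded (V i) \<and> diameter (V i) \<le> \<epsilon>) \<and>
        (\<Sum>i. hausdorff_weight k (V i)) < \<eta>"
      by blast
  qed
qed

lemma hausdorff_measure_0_finite_coverI:
  assumes "\<And>\<epsilon> \<eta> :: real. \<epsilon> > 0 \<Longrightarrow> \<eta> > 0 \<Longrightarrow> \<exists>(I :: 'i set) V. finite I \<and> A \<subseteq> (\<Union>i\<in>I. V i) \<and>
     (\<forall>i\<in>I. bounded (V i) \<and> diameter (V i) \<le> \<epsilon>) \<and> (\<Sum>i\<in>I. hausdorff_weight k (V i)) < ennreal \<eta>"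
  shows "hausdorff_measure k A = 0"
  unfolding hausdorff_measure_eq_0_iff
proof (intro allI impI)
  fix \<epsilon> :: real and \<eta> :: ennreal assume "\<epsilon> > 0" "\<eta> > 0"
  obtain e :: real where e: "e > 0" "ennreal e < \<eta>"
    using \<open>\<eta> > 0\<close> by (rule ennreal_pos_real_below)
  obtain I :: "'i set" and V where V: "finite I" "A \<subseteq> (\<Union>i\<in>I. V i)"
     "\<forall>i\<in>I. bounded (V i) \<and> diameter (V i) \<le> \<epsilon>" "(\<Sum>i\<in>I. hausdorff_weight k (V i)) < ennreal e"
    using assms[OF \<open>\<epsilon> > 0\<close> \<open>e > 0\<close>] by blast
  obtain f where f: "bij_betw f {..<card I} I"
    using ex_bij_betw_nat_finite[OF V(1)] by (auto simp: atLeast0LessThan)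
  \<comment> \<open>Padding by empty sets is free because \<open>hausdorff_weight\<close> treats
    them separately; for \<open>k = 0\<close> the general formula would charge 1 for each.\<close>
  define U where "U n = (if n < card I then V (f n) else {})" for n
  have "(\<Sum>n. hausdorff_weight k (U n)) = (\<Sum>n\<in>{..<card I}. hausdorff_weight k (U n))"
    by (rule suminf_finite) (auto simp: U_def hausdorff_weight_def)
  also have "\<dots> = (\<Sum>n\<in>{..<card I}. hausdorff_weight k (V (f n)))"
    by (simp add: U_def)
  also have "\<dots> = (\<Sum>i\<in>I. hausdorff_weight k (V i))"
    by (rule sum.reindex_bij_betw[OF f])
  finally have "(\<Sum>n. hausdorff_weight k (U n)) < \<eta>"
    using V(4) e by simp
  moreover have "A \<subseteq> (\<Union>n. U n)"
  proof
    fix x assume "x \<in> A"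
    then obtain i where "i \<in> I" "x \<in> V i" using V(2) by blast
    moreover obtain n where "n < card I" "i = f n"
      using f \<open>i \<in> I\<close> by (metis bij_betw_imp_surj_on imageE lessThan_iff)
    ultimately have "x \<in> U n" by (simp add: U_def)
    then show "x \<in> (\<Union>n. U n)" by blast
  qed
  moreover have "bounded (U n) \<and> diameter (U n) \<le> \<epsilon>" for n
  proof (cases "n < card I")
    case True
    then have "f n \<in> I" using f by (auto simp: bij_betw_def)
    then show ?thesis using V(3) True by (simp add: U_def)
  qed (use \<open>\<epsilon> > 0\<close> in \<open>simp add: U_def\<close>)
  ultimately show "\<exists>U. A \<subseteq> (\<Union>i. U i) \<and> (\<forall>i::nat. bounded (U i) \<and> diameter (U i) \<le> \<epsilon>) \<and>
        (\<Sum>i. hausdorff_weight k (U i)) < \<eta>"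
    by blast
qed

text \<open>A grid of mesh 2R/m divides the d - 2 free coordinates into m^(d-2) cells, whose images
  have diameter O(1/m). Weighted with exponent d - 1 they cost O(1/m) in total.\<close>

lemma hausdorff_measure_0_nonexpansive_image_slab:
  fixes f :: "'a::euclidean_space \<Rightarrow> 'a" and R :: real
  assumes f: "\<And>x y. dist (f x) (f y) \<le> dist x y"
    and ij: "i \<in> Basis" "j \<in> Basis" "i \<noteq> j" and "R > 0"
  shows "hausdorff_measure (DIM('a) - 1)
    (f ` {y. y \<bullet> i = p \<and> y \<bullet> j = q \<and> (\<forall>b\<in>Basis. \<bar>y \<bullet> b\<bar> < R)}) = 0"
proof (rule hausdorff_measure_0_finite_coverI)
  fix \<epsilon> \<eta> :: real assume "\<epsilon> > 0" "\<eta> > 0"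
  define d where "d = DIM('a)"
  define F where "F = {y::'a. y \<bullet> i = p \<and> y \<bullet> j = q \<and> (\<forall>b\<in>Basis. \<bar>y \<bullet> b\<bar> < R)}"
  define B where "B = Basis - {i, j}"
  have "card {i, j} = 2" "{i, j} \<subseteq> (Basis :: 'a set)" using ij by auto
  then have d2: "d \<ge> 2" and cB: "card B = d - 2"
    unfolding d_def B_def by (metis card_mono finite_Basis, metis card_Diff_subset finite.intros(1) finite_insert)
  define c where "c = unit_ball_vol (real (d - 1))"
  have c: "c \<ge> 0" unfolding c_def by simp
  \<comment> \<open>With mesh \<open>s = 2 * R / m\<close>, the bounds concern the diameter
    \<open>d * s\<close> of a cell and the total weight m^(d-2) * c * (d * s / 2)^(d-1).\<close>
  obtain m :: nat where m: "m > 0" "2 * real d * R / m < \<epsilon>" "c * (real d * R) ^ (d - 1) / m < \<eta>"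
  proof -
    have "(\<lambda>m. 2 * real d * R / real m) \<longlonglongrightarrow> 0" "(\<lambda>m. c * (real d * R) ^ (d - 1) / real m) \<longlonglongrightarrow> 0"
      by (rule lim_const_over_n)+
    then have "\<forall>\<^sub>F m in sequentially. 2 * real d * R / real m < \<epsilon>"
       "\<forall>\<^sub>F m in sequentially. c * (real d * R) ^ (d - 1) / real m < \<eta>"
      using \<open>\<epsilon> > 0\<close> \<open>\<eta> > 0\<close> by (auto intro: order_tendstoD)
    then have "\<forall>\<^sub>F m in sequentially. m > 0 \<and> 2 * real d * R / real m < \<epsilon> \<and> c * (real d * R) ^ (d - 1) / real m < \<eta>"
      using eventually_gt_at_top[of 0] by eventually_elim simp
    then show ?thesis using that by (auto dest!: eventually_happens)
  qed
  define s where "s = 2 * R / m"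
  have s: "s > 0" using m \<open>R > 0\<close> by (simp add: s_def)
  \<comment> \<open>The two coordinates outside \<open>B\<close> are fixed on \<open>F\<close>.
    Extensional functions are used so that \<open>I\<close> is finite.\<close>
  define I where "I = (\<Pi>\<^sub>E b\<in>B. {..<m})"
  define V where "V k = f ` {y \<in> F. \<forall>b\<in>B. real (k b) * s \<le> y \<bullet> b + R \<and> y \<bullet> b + R \<le> real (k b + 1) * s}" for k
  have "finite B" by (simp add: B_def)
  then have finI: "finite I" and cI: "card I = m ^ (d - 2)"
    unfolding I_def by (auto intro: finite_PiE simp: card_PiE cB)
  have dist_V: "dist x y \<le> d * s" if xV: "x \<in> V k" and yV: "y \<in> V k" for x y k
  proof -
    obtain x' where x': "x = f x'" "x' \<in> F"
       "\<forall>b\<in>B. real (k b) * s \<le> x' \<bullet> b + R \<and> x' \<bullet> b + R \<le> real (k b + 1) * s"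
      using xV unfolding V_def by blast
    obtain y' where y': "y = f y'" "y' \<in> F"
       "\<forall>b\<in>B. real (k b) * s \<le> y' \<bullet> b + R \<and> y' \<bullet> b + R \<le> real (k b + 1) * s"
      using yV unfolding V_def by blast
    have "dist x y \<le> dist x' y'" using f x' y' by simp
    also have "\<dots> \<le> (\<Sum>b\<in>Basis. \<bar>(x' - y') \<bullet> b\<bar>)" unfolding dist_norm by (rule norm_le_l1)
    also have "\<dots> \<le> (\<Sum>b\<in>(Basis::'a set). s)"
    proof (rule sum_mono)
      fix b :: 'a assume "b \<in> Basis"
      show "\<bar>(x' - y') \<bullet> b\<bar> \<le> s"
      proof (cases "b \<in> B")
        case True
        then show ?thesis using bspec[OF x'(3) True] bspec[OF y'(3) True] by (simp add: inner_diff_left algebra_simps) linarith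
      next
        case False
        then have "b = i \<or> b = j" using \<open>b \<in> Basis\<close> by (auto simp: B_def)
        then show ?thesis using x'(2) y'(2) s by (auto simp: F_def inner_diff_left)
      qed
    qed
    finally show ?thesis by (simp add: d_def)
  qed
  have bV: "bounded (V k)" for k
    unfolding bounded_def using dist_V[of _ k] by (cases "V k = {}") blast+
  have ds: "0 \<le> real d * s" "real d * s \<le> \<epsilon>" using s m by (auto simp: s_def field_simps)
  have diamV: "diameter (V k) \<le> real d * s" for k
    using dist_V[of _ k] ds by (intro diameter_le) (auto simp: dist_norm)
  have "hausdorff_weight (d - 1) (V k) \<le> ennreal (c * (real d * s / 2) ^ (d - 1))" for k
  proof (cases "V k = {}")
    case False
    show ?thesis
      unfolding hausdorff_weight_def c_def using False diamV[of k] bV[of k]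
      by (simp add: diameter_ge_0 ennreal_leI mult_left_mono power_mono)
  qed (simp add: hausdorff_weight_def)
  then have "(\<Sum>k\<in>I. hausdorff_weight (d - 1) (V k)) \<le> (\<Sum>k\<in>I. ennreal (c * (real d * s / 2) ^ (d - 1)))"
    by (intro sum_mono)
  also have "\<dots> = ennreal (real (m ^ (d - 2)) * (c * (real d * s / 2) ^ (d - 1)))"
    using c ds by (simp add: cI ennreal_mult ennreal_of_nat_eq_real_of_nat)
  also have "real (m ^ (d - 2)) * (c * (real d * s / 2) ^ (d - 1)) = c * (real d * R) ^ (d - 1) / m"
  proof -
    obtain e where "d = Suc (Suc e)" using d2 by (metis Suc_le_D numeral_2_eq_2 Suc_le_mono)
    moreover have "real d * s / 2 = real d * R / m" by (simp add: s_def)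
    ultimately show ?thesis using m by (simp add: power_divide del: of_nat_Suc)
  qed
  also have "ennreal \<dots> < ennreal \<eta>" using m \<open>\<eta> > 0\<close> by (simp add: ennreal_lessI)
  finally have sum: "(\<Sum>k\<in>I. hausdorff_weight (d - 1) (V k)) < ennreal \<eta>" .
  have "f ` F \<subseteq> (\<Union>k\<in>I. V k)"
  proof
    fix x assume "x \<in> f ` F"
    then obtain y where y: "y \<in> F" "x = f y" by blast
    define k where "k = restrict (\<lambda>b. nat \<lfloor>(y \<bullet> b + R) / s\<rfloor>) B"
    have k: "k b < m" "real (k b) * s \<le> y \<bullet> b + R" "y \<bullet> b + R \<le> real (k b + 1) * s" if "b \<in> B" for b
    proof -
      have yb: "\<bar>y \<bullet> b\<bar> < R" using y that by (auto simp: F_def B_def)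
      define t where "t = (y \<bullet> b + R) / s"
      have "m * s = 2 * R" using m by (simp add: s_def)
      then have t: "0 \<le> t" "t < m" using yb s by (auto simp: t_def pos_divide_less_eq)
      have kb: "real (k b) = of_int \<lfloor>t\<rfloor>" using that t by (simp add: k_def t_def[symmetric])
      have yt: "y \<bullet> b + R = t * s" using s by (simp add: t_def)
      show "k b < m" using kb t by linarith
      show "real (k b) * s \<le> y \<bullet> b + R" unfolding yt using kb s by (intro mult_right_mono) linarith+
      show "y \<bullet> b + R \<le> real (k b + 1) * s" unfolding yt using kb s by (intro mult_right_mono) linarith+
    qed
    then have "k \<in> I" by (auto simp: I_def k_def)
    moreover have "x \<in> V k" using k y unfolding V_def by blast
    ultimately show "x \<in> (\<Union>k\<in>I. V k)" by blast
  qed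
  then show "\<exists>(I::('a \<Rightarrow> nat) set) V. finite I \<and>
      f ` {y. y \<bullet> i = p \<and> y \<bullet> j = q \<and> (\<forall>b\<in>Basis. \<bar>y \<bullet> b\<bar> < R)} \<subseteq> (\<Union>i\<in>I. V i) \<and>
     (\<forall>i\<in>I. bounded (V i) \<and> diameter (V i) \<le> \<epsilon>) \<and> (\<Sum>i\<in>I. hausdorff_weight (DIM('a) - 1) (V i)) < ennreal \<eta>"
    using finI bV order_trans[OF diamV ds(2)] sum unfolding F_def[symmetric] d_def[symmetric] by blast
qed

lemma hausdorff_measure_0_nonexpansive_image_flat:
  fixes f :: "'a::euclidean_space \<Rightarrow> 'a"
  assumes f: "\<And>x y. dist (f x) (f y) \<le> dist x y"
    and ij: "i \<in> Basis" "j \<in> Basis" "i \<noteq> j"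
  shows "hausdorff_measure (DIM('a) - 1) (f ` {y. y \<bullet> i = p \<and> y \<bullet> j = q}) = 0"
proof -
  let ?S = "\<lambda>R. {y. y \<bullet> i = p \<and> y \<bullet> j = q \<and> (\<forall>b\<in>Basis. \<bar>y \<bullet> b\<bar> < R)}"
  have "f ` {y. y \<bullet> i = p \<and> y \<bullet> j = q} \<subseteq> (\<Union>n::nat. f ` ?S (real (Suc n)))"
  proof
    fix x assume "x \<in> f ` {y. y \<bullet> i = p \<and> y \<bullet> j = q}"
    then obtain y where y: "x = f y" "y \<bullet> i = p" "y \<bullet> j = q" by blast
    obtain n :: nat where "norm y < n" using reals_Archimedean2 by blast
    then have "y \<in> ?S (real (Suc n))" using y Basis_le_norm[of _ y] by force
    then show "x \<in> (\<Union>n::nat. f ` ?S (real (Suc n)))" using y by blast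
  qed
  moreover have "hausdorff_measure (DIM('a) - 1) (\<Union>n::nat. f ` ?S (real (Suc n))) = 0"
    by (intro hausdorff_measure_0_UN hausdorff_measure_0_nonexpansive_image_slab assms) auto
  ultimately show ?thesis by (rule hausdorff_measure_0_subset[rotated])
qed

text \<open>The truncated cone over a set of diameter at most r lies in a tube around one ray from
  \<open>z\<close>, covered by about T/r balls of radius (R + T) r. Its volume is thus of order
  r^(d-1), the order of the Hausdorff weight of the set. So covers of \<open>A\<close> of small
  total weight force \<open>G\<close> to have arbitrarily small Lebesgue measure.\<close>

lemma open_subset_cone_hausdorff_null_empty:
  fixes A G :: "'a::euclidean_space set"
  assumes null: "hausdorff_measure (DIM('a) - 1) A = 0" and dim: "2 \<le> DIM('a)"
    and A: "A \<subseteq> cball z R" and "R > 0" and "T > 0" and "open G"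
    and G: "\<And>w. w \<in> G \<Longrightarrow> \<exists>x\<in>A. \<exists>t. 0 \<le> t \<and> t \<le> T \<and> w = z + t *\<^sub>R (x - z)"
  shows "G = {}"
proof (rule ccontr)
  assume "G \<noteq> {}"
  define d where "d = DIM('a)"
  define v where "v = unit_ball_vol (real d)"
  define v' where "v' = unit_ball_vol (real (d - 1))"
  have v: "v > 0" "v' > 0" by (simp_all add: v_def v'_def)
  \<comment> \<open>\<open>C * r ^ (d - 1)\<close> bounds the volume of a tube: at most (T + 1)/r
    balls of volume \<open>v * ((R + T) * r) ^ d\<close>. The constant \<open>D\<close> absorbs the
    normalisation of the Hausdorff weight.\<close>
  define C where "C = (T + 1) * v * (R + T) ^ d"
  define D where "D = C * 2 ^ (d - 1) / v'"
  have CD: "C > 0" "D > 0" using v \<open>R > 0\<close> \<open>T > 0\<close> by (auto simp: C_def D_def)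
  have bound: "emeasure lborel G \<le> ennreal ((D + C) * e)" if e: "0 < e" "e \<le> 1" for e
  proof -
    have "\<exists>U. A \<subseteq> (\<Union>i. U i) \<and> (\<forall>i::nat. bounded (U i) \<and> diameter (U i) \<le> 1) \<and>
        (\<Sum>i. hausdorff_weight (d - 1) (U i)) < ennreal e"
      using null e unfolding hausdorff_measure_eq_0_iff d_def by simp
    then obtain U where U: "A \<subseteq> (\<Union>i::nat. U i)" "\<And>i. bounded (U i)" "\<And>i. diameter (U i) \<le> 1"
        "(\<Sum>i. hausdorff_weight (d - 1) (U i)) < ennreal e" by blast
    define \<delta> where "\<delta> i = e * (1/2) ^ Suc i" for i
    \<comment> \<open>A covering set may have diameter 0, but the step along the ray must be
      positive. The corrections \<open>\<delta> i\<close> sum to \<open>e\<close>; the bound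
      \<open>r i \<le> 1\<close> later gives T/r + 1 \<le> (T + 1)/r.\<close>
    define r where "r i = max (diameter (U i)) (\<delta> i)" for i
    have \<delta>: "0 < \<delta> i" "\<delta> i \<le> 1" for i
    proof -
      show "0 < \<delta> i" using e by (simp add: \<delta>_def)
      have "(1/2::real) ^ Suc i \<le> 1" by (rule power_le_one) auto
      then show "\<delta> i \<le> 1" unfolding \<delta>_def using e by (intro mult_le_one) auto
    qed
    have r: "0 < r i" "r i \<le> 1" for i
      using \<delta>[of i] U(3)[of i] by (auto simp: r_def)
    define y where "y i = (SOME y. y \<in> U i)" for i
    define n where "n i = nat \<lfloor>T / r i\<rfloor>" for i
    \<comment> \<open>The centres advance in steps of length parameter \<open>r i\<close> along the
      ray from \<open>z\<close> through the chosen point \<open>y i\<close> of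
      \<open>U i\<close>.\<close>
    define W where "W i j = cball (z + (real j * r i) *\<^sub>R (y i - z)) ((R + T) * r i)" for i j
    define V where "V i = (if U i = {} then {} else (\<Union>j\<le>n i. W i j))" for i
    have Vm: "V i \<in> sets lborel" for i by (auto simp: V_def W_def)
    have emW: "emeasure lborel (W i j) = ennreal (v * ((R + T) * r i) ^ d)" for i j
      unfolding W_def v_def d_def using r[of i] \<open>R > 0\<close> \<open>T > 0\<close> by (intro emeasure_cball) simp
    have emV: "emeasure lborel (V i) \<le> ennreal D * hausdorff_weight (d - 1) (U i) + ennreal (C * \<delta> i)" for i
    proof (cases "U i = {}")
      case False
      obtain k where k: "d = Suc k" "k \<ge> 1" using dim unfolding d_def[symmetric] by (cases d) auto
      have Tr: "0 \<le> T / r i" using r[of i] \<open>T > 0\<close> by simp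
      have n1: "real (n i + 1) \<le> (T + 1) / r i"
      proof -
        have "real (n i + 1) \<le> T / r i + 1" unfolding n_def using Tr by linarith
        also have "\<dots> \<le> (T + 1) / r i" using r[of i] by (simp add: field_simps)
        finally show ?thesis .
      qed
      have "emeasure lborel (V i) \<le> (\<Sum>j\<le>n i. emeasure lborel (W i j))"
        unfolding V_def using False by (auto intro!: emeasure_subadditive_finite simp: W_def)
      also have "\<dots> = ennreal (real (n i + 1) * (v * ((R + T) * r i) ^ d))"
        unfolding emW using r[of i] v \<open>R > 0\<close> \<open>T > 0\<close>
        by (subst sum_constant) (simp add: ennreal_mult ennreal_of_nat_eq_real_of_nat del: of_nat_Suc)
      also have "real (n i + 1) * (v * ((R + T) * r i) ^ d) \<le> (T + 1) / r i * (v * ((R + T) * r i) ^ d)"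
        using n1 v r[of i] \<open>R > 0\<close> \<open>T > 0\<close> by (intro mult_right_mono) auto
      also have "\<dots> = C * r i ^ k"
        using r[of i] by (simp add: C_def k power_mult_distrib)
      also have "r i ^ k \<le> diameter (U i) ^ k + \<delta> i"
      proof -
        \<comment> \<open>This is where dimension at least 2 enters: \<open>k \<ge> 1\<close>
          together with \<open>\<delta> i \<le> 1\<close>.\<close>
        have "\<delta> i ^ k \<le> \<delta> i" using \<delta>[of i] k by (metis less_imp_le power_decreasing power_one_right)
        moreover have "0 \<le> diameter (U i) ^ k" using diameter_ge_0[OF U(2)] by simp
        ultimately show ?thesis using \<delta>(1)[of i] by (auto simp: r_def max_def)
      qed
      also have "C * (diameter (U i) ^ k + \<delta> i) = D * (v' * (diameter (U i) / 2) ^ k) + C * \<delta> i"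
        using v by (simp add: D_def k power_divide field_simps)
      also have "ennreal \<dots> = ennreal D * hausdorff_weight (d - 1) (U i) + ennreal (C * \<delta> i)"
        unfolding hausdorff_weight_def v'_def using False CD \<delta>[of i] v diameter_ge_0[OF U(2), of i]
        by (simp add: ennreal_mult ennreal_plus k)
      finally show ?thesis using CD by (simp add: ennreal_leI mult_left_mono)
    qed (simp add: V_def)
    have "G \<subseteq> (\<Union>i. V i)"
    proof
      fix w assume "w \<in> G"
      then obtain x t where x: "x \<in> A" "0 \<le> t" "t \<le> T" "w = z + t *\<^sub>R (x - z)" using G by blast
      then obtain i where i: "x \<in> U i" using U(1) by blast
      then have yi: "y i \<in> U i" unfolding y_def by (rule someI)
      define j where "j = nat \<lfloor>t / r i\<rfloor>"
      have "0 \<le> t / r i" "t / r i \<le> T / r i" using x r[of i] by (auto intro: divide_right_mono)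
      then have j: "j \<le> n i" "real j \<le> t / r i" "t / r i \<le> real j + 1"
        unfolding j_def n_def by (auto intro!: nat_mono floor_mono)
      have jt: "real j * r i \<le> t" "t \<le> real j * r i + r i"
        using j r[of i] by (auto simp: field_simps)
      \<comment> \<open>The error splits into rounding \<open>t\<close> down to a multiple of
        \<open>r i\<close>, at most \<open>r i * R\<close>, and replacing \<open>x\<close> by
        \<open>y i\<close>, at most \<open>T * r i\<close>.\<close>
      have "w - (z + (real j * r i) *\<^sub>R (y i - z)) = (t - real j * r i) *\<^sub>R (x - z) + (real j * r i) *\<^sub>R (x - y i)"
        by (simp add: x(4) algebra_simps)
      also have "norm \<dots> \<le> (t - real j * r i) * norm (x - z) + (real j * r i) * norm (x - y i)"
        using jt r[of i] by (intro order_trans[OF norm_triangle_ineq]) simp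
      also have "\<dots> \<le> r i * R + T * r i"
      proof (intro add_mono mult_mono)
        show "norm (x - z) \<le> R" using A x(1) by (auto simp: dist_norm norm_minus_commute)
        show "norm (x - y i) \<le> r i"
          using diameter_bounded_bound[OF U(2) i yi] by (simp add: r_def dist_norm)
      qed (use jt x r[of i] \<open>T > 0\<close> in auto)
      finally have "w \<in> W i j"
        by (simp add: W_def dist_norm norm_minus_commute algebra_simps)
      then show "w \<in> (\<Union>i. V i)" using i j(1) by (auto simp: V_def)
    qed
    then have "emeasure lborel G \<le> emeasure lborel (\<Union>i. V i)"
      using Vm by (intro emeasure_mono) auto
    also have "\<dots> \<le> (\<Sum>i. emeasure lborel (V i))"
      using Vm by (intro emeasure_subadditive_countably) auto
    also have "\<dots> \<le> (\<Sum>i. ennreal D * hausdorff_weight (d - 1) (U i) + ennreal (C * \<delta> i))"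
      by (intro suminf_le emV) auto
    also have "\<dots> = ennreal D * (\<Sum>i. hausdorff_weight (d - 1) (U i)) + (\<Sum>i. ennreal (C * \<delta> i))"
      by (simp add: suminf_add[symmetric])
    also have "(\<Sum>i. ennreal (C * \<delta> i)) = ennreal (C * e)"
    proof -
      have "(\<lambda>i. C * \<delta> i) sums (C * e)"
        unfolding \<delta>_def using sums_mult[OF sums_mult[OF power_half_series, of e], of C] by simp
      then show ?thesis using CD \<delta> by (intro suminf_ennreal_eq) (auto intro: less_imp_le)
    qed
    also have "ennreal D * (\<Sum>i. hausdorff_weight (d - 1) (U i)) \<le> ennreal D * ennreal e"
      using U(4) by (intro mult_left_mono) auto
    finally show ?thesis
      using CD e by (simp add: ennreal_mult[symmetric] ennreal_plus[symmetric] algebra_simps del: ennreal_plus)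
  qed
  have "G \<notin> null_sets lborel"
    using open_not_negligible[OF \<open>open G\<close> \<open>G \<noteq> {}\<close>] null_sets_completionI[of G lborel]
    by (auto simp: negligible_iff_null_sets)
  then have "emeasure lborel G > 0"
    using \<open>open G\<close> by (auto simp: null_sets_def zero_less_iff_neq_zero)
  then obtain x where x: "x > 0" "ennreal x < emeasure lborel G" by (rule ennreal_pos_real_below)
  have "emeasure lborel G \<le> ennreal ((D + C) * min 1 (x / (D + C)))"
    using x CD by (intro bound) auto
  also have "\<dots> \<le> ennreal ((D + C) * (x / (D + C)))"
    using CD by (intro ennreal_leI mult_left_mono) auto
  also have "\<dots> = ennreal x" using CD by simp
  finally show False using x by simp
qed


section \<open>Intersections of supporting halfspaces\<close>

text \<open>For compact \<open>K\<close>, the inner existential says \<open>x \<bullet> u \<le> h_K(u)\<close>, so this is the intersection of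
  the supporting halfspaces of \<open>K\<close> with outer normals in \<open>C\<close>.\<close>

definition normal_hull :: "'a::euclidean_space set \<Rightarrow> 'a set \<Rightarrow> 'a set" where
  "normal_hull K C = {x. \<forall>u\<in>C. \<exists>y\<in>K. x \<bullet> u \<le> y \<bullet> u}"

lemma subset_normal_hull: "K \<subseteq> normal_hull K C"
  by (auto simp: normal_hull_def)

lemma convex_normal_hull:
  assumes "convex K"
  shows "convex (normal_hull K C)"
proof (rule convexI)
  fix x y :: 'a and a b :: real
  assume x: "x \<in> normal_hull K C" and y: "y \<in> normal_hull K C" and ab: "0 \<le> a" "0 \<le> b" "a + b = 1"
  show "a *\<^sub>R x + b *\<^sub>R y \<in> normal_hull K C"
    unfolding normal_hull_def
  proof (intro CollectI ballI)
    fix u assume "u \<in> C"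
    then obtain x' y' where "x' \<in> K" "x \<bullet> u \<le> x' \<bullet> u" and "y' \<in> K" "y \<bullet> u \<le> y' \<bullet> u"
      using x y unfolding normal_hull_def by blast
    note * = this
    then have "a *\<^sub>R x' + b *\<^sub>R y' \<in> K" using \<open>convex K\<close> ab by (auto intro: convexD)
    moreover have "(a *\<^sub>R x + b *\<^sub>R y) \<bullet> u \<le> (a *\<^sub>R x' + b *\<^sub>R y') \<bullet> u"
      using * ab by (simp add: inner_add_left add_mono mult_left_mono)
    ultimately show "\<exists>z\<in>K. (a *\<^sub>R x + b *\<^sub>R y) \<bullet> u \<le> z \<bullet> u" by blast
  qed
qed

lemma outer_unit_normal_exists:
  assumes "convex_body K" "x \<in> frontier K"
  obtains u where "outer_unit_normal K x u"
proof -
  have K: "convex K" "closed K" "interior K \<noteq> {}"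
    using assms by (auto simp: convex_body_def compact_imp_closed)
  then have "x \<in> K" "x \<notin> rel_interior K"
    using assms(2) by (auto simp: frontier_def rel_interior_nonempty_interior)
  then obtain a where a: "a \<noteq> 0" "\<And>y. y \<in> K \<Longrightarrow> a \<bullet> x \<le> a \<bullet> y"
    using supporting_hyperplane_rel_boundary[OF K(1)] by metis
  \<comment> \<open>The supporting functional \<open>a\<close> is minimal at \<open>x\<close>, so it
    points inwards and has to be negated.\<close>
  have "outer_unit_normal K x (- (inverse (norm a) *\<^sub>R a))"
    unfolding outer_unit_normal_def using a by (auto simp: inner_commute intro!: mult_left_mono)
  then show thesis by (rule that)
qed

text \<open>A small step from \<open>x\<close> along \<open>u\<close> stays in the hull, whereas a
  normal \<open>u\<close> at \<open>x\<close> means that \<open>x\<close> already attains the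
  maximum of K in direction \<open>u\<close>.\<close>

lemma not_outer_unit_normal_interior_normal_hull:
  assumes "x \<in> interior (normal_hull K C)" "u \<in> C"
  shows "\<not> outer_unit_normal K x u"
proof
  assume u: "outer_unit_normal K x u"
  obtain e where e: "e > 0" "cball x e \<subseteq> normal_hull K C"
    using assms(1) mem_interior_cball by blast
  have "x + e *\<^sub>R u \<in> cball x e" using e u by (simp add: dist_norm outer_unit_normal_def)
  then have "x + e *\<^sub>R u \<in> normal_hull K C" using e by blast
  then obtain y where "y \<in> K" "(x + e *\<^sub>R u) \<bullet> u \<le> y \<bullet> u"
    using assms(2) by (auto simp: normal_hull_def)
  moreover have "u \<bullet> u = 1" using u by (simp add: outer_unit_normal_def norm_eq_1)
  moreover have "y \<bullet> u \<le> x \<bullet> u" using u \<open>y \<in> K\<close> by (simp add: outer_unit_normal_def)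
  ultimately show False using e by (simp add: inner_add_left)
qed

lemma normal_hull_support_surface_area_measure:
  fixes K :: "'a::euclidean_space set"
  assumes K: "convex_body K" and dim: "2 \<le> DIM('a)"
  shows "normal_hull K (support (top_of_set (sphere 0 1)) (surface_area_measure K)) = K"
proof (rule ccontr)
  define C where "C = support (top_of_set (sphere 0 1)) (surface_area_measure K)"
  define P where "P = normal_hull K C"
  assume "normal_hull K (support (top_of_set (sphere 0 1)) (surface_area_measure K)) \<noteq> K"
  then obtain p where p: "p \<in> P" "p \<notin> K"
    using subset_normal_hull unfolding P_def C_def by blast
  have cK: "compact K" "convex K" and clK: "closed K"
    using K by (auto simp: convex_body_def compact_imp_closed)
  obtain z where z: "z \<in> interior K" using K by (auto simp: convex_body_def)
  obtain \<rho> where \<rho>: "\<rho> > 0" "ball z \<rho> \<subseteq> K" using z mem_interior by blast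
  obtain R where R: "R > 0" "K \<subseteq> ball z R"
    using bounded_subset_ballD[OF compact_imp_bounded[OF cK(1)]] by blast
  have KP: "K \<subseteq> P" unfolding P_def by (rule subset_normal_hull)
  have conP: "convex P" unfolding P_def by (rule convex_normal_hull) fact
  have zP: "z \<in> interior P" using interior_mono[OF KP] z by blast
  define A where "A = frontier K \<inter> interior P"
  \<comment> \<open>The summand 1 makes \<open>r\<close> positive and puts points near
    \<open>p\<close> strictly inside the ball.\<close>
  define r where "r = norm (p - z) + 1"
  have r: "r > 0" unfolding r_def by (simp add: add_nonneg_pos)
  \<comment> \<open>Cutting down to a ball bounds the factor by which boundary points in
    \<open>A\<close> must be stretched from \<open>z\<close> to reach \<open>G\<close>.\<close>
  define G where "G = (interior P - K) \<inter> ball z r"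
  have "open G" unfolding G_def using clK by (intro open_Int open_Diff) auto
  have "hausdorff_measure (DIM('a) - 1) A = 0"
  proof -
    \<comment> \<open>Each point of \<open>A\<close> has a normal, necessarily outside
      \<open>C\<close>, hence in some open set of surface area measure zero; countably many of these
      sets suffice.\<close>
    define \<U> where "\<U> = {U. openin (top_of_set (sphere (0::'a) 1)) U \<and> surface_area_measure K U = 0}"
    obtain \<V> where V: "\<V> \<subseteq> \<U>" "countable \<V>" "\<Union>\<V> = \<Union>\<U>"
      using Lindelof_openin[of \<U> "sphere (0::'a) 1"] unfolding \<U>_def by blast
    have "A \<subseteq> (\<Union>U\<in>\<V>. {x \<in> frontier K. \<exists>u\<in>U. outer_unit_normal K x u})"
    proof
      fix x assume x: "x \<in> A"
      then obtain u where u: "outer_unit_normal K x u"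
        using outer_unit_normal_exists[OF K] by (auto simp: A_def)
      then have "u \<notin> C"
        using not_outer_unit_normal_interior_normal_hull[of x K C u] x by (auto simp: A_def P_def)
      moreover have "u \<in> sphere 0 1" using u by (simp add: outer_unit_normal_def)
      ultimately obtain U where "openin (top_of_set (sphere 0 1)) U" "u \<in> U" "surface_area_measure K U = 0"
        by (auto simp: C_def support_def not_gr_zero)
      then have "u \<in> \<Union>\<V>" unfolding V(3) \<U>_def by blast
      then show "x \<in> (\<Union>U\<in>\<V>. {x \<in> frontier K. \<exists>u\<in>U. outer_unit_normal K x u})"
        using u x by (auto simp: A_def)
    qed
    moreover have "hausdorff_measure (DIM('a) - 1) (\<Union>U\<in>\<V>. {x \<in> frontier K. \<exists>u\<in>U. outer_unit_normal K x u}) = 0"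
      using V(1,2) by (intro hausdorff_measure_0_UN) (auto simp: \<U>_def surface_area_measure_def)
    ultimately show ?thesis by (rule hausdorff_measure_0_subset[rotated])
  qed
  moreover have "A \<subseteq> cball z R"
    using R(2) frontier_subset_closed[OF clK] ball_subset_cball[of z R] by (auto simp: A_def)
  moreover have "\<exists>x\<in>A. \<exists>t. 0 \<le> t \<and> t \<le> r / \<rho> \<and> w = z + t *\<^sub>R (x - z)" if "w \<in> G" for w
  proof -
    have w: "w \<in> interior P" "w \<notin> K" "norm (w - z) < r"
      using that by (auto simp: G_def dist_norm norm_minus_commute)
    have "closed_segment z w \<inter> frontier K \<noteq> {}"
      using w z interior_subset[of K] by (intro connected_Int_frontier) auto
    then obtain x where x: "x \<in> closed_segment z w" "x \<in> frontier K" by blast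
    have "closed_segment z w \<subseteq> interior P"
      using convex_interior[OF conP] zP w(1) by (rule closed_segment_subset[rotated 2])
    then have "x \<in> A" using x by (auto simp: A_def)
    obtain s where s: "0 \<le> s" "s \<le> 1" "x = z + s *\<^sub>R (w - z)"
      using x(1) by (auto simp: closed_segment_def algebra_simps)
    \<comment> \<open>The distance of the boundary point from \<open>z\<close> is at least
      \<open>\<rho>\<close>, which keeps the stretching factor \<open>1 / s\<close> at most
      \<open>r / \<rho>\<close>.\<close>
    have "x \<notin> ball z \<rho>"
      using x(2) interior_maximal[OF \<rho>(2)] by (auto simp: frontier_def)
    then have "\<rho> \<le> norm (x - z)" by (simp add: dist_norm norm_minus_commute)
    also have "\<dots> = s * norm (w - z)" using s by simp
    finally have sw: "\<rho> \<le> s * norm (w - z)" .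
    then have "s \<noteq> 0" using \<rho>(1) by auto
    then have "s > 0" using s by simp
    have "\<rho> \<le> s * r" using sw w(3) s(1) by (meson less_imp_le mult_left_mono order_trans)
    then have "1 / s \<le> r / \<rho>" using \<open>s > 0\<close> \<rho>(1) by (simp add: field_simps)
    moreover have "w = z + (1 / s) *\<^sub>R (x - z)" using s \<open>s > 0\<close> by simp
    ultimately show ?thesis using \<open>x \<in> A\<close> \<open>s > 0\<close> by (intro bexI[of _ x] exI[of _ "1 / s"]) auto
  qed
  ultimately have "G = {}"
    using \<open>open G\<close> R(1) r \<rho>(1) by (intro open_subset_cone_hausdorff_null_empty[OF _ dim, of A z R "r / \<rho>" G]) auto
  moreover have "G \<noteq> {}"
  proof -
    have "open (- K)" "p \<in> - K" using clK p by auto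
    then obtain e where e: "e > 0" "ball p e \<subseteq> - K" by (meson openE)
    \<comment> \<open>The point \<open>p\<close> may lie on the boundary of \<open>P\<close>. Moving
      it slightly towards \<open>z\<close> enters the interior, and a displacement of at most e/2
      keeps it off \<open>K\<close>.\<close>
    define s where "s = min 1 (e / (2 * r))"
    have s: "s > 0" "s \<le> 1" "s \<le> e / (2 * r)" using e r by (auto simp: s_def)
    define w where "w = p - s *\<^sub>R (p - z)"
    have "w \<in> interior P"
      unfolding w_def using mem_interior_convex_shrink[OF conP zP p(1)] s by blast
    moreover have "norm (p - w) < e"
    proof -
      have "norm (p - w) = s * norm (p - z)" using s by (simp add: w_def)
      also have "\<dots> \<le> s * r" using s by (simp add: r_def)
      also have "\<dots> \<le> e / (2 * r) * r" using s r by (intro mult_right_mono) auto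
      also have "\<dots> < e" using e r by simp
      finally show ?thesis .
    qed
    then have "w \<notin> K" using e by (auto simp: dist_norm subset_iff)
    moreover have "w - z = (1 - s) *\<^sub>R (p - z)" by (simp add: w_def algebra_simps)
    then have "norm (w - z) \<le> norm (p - z)" using s by (simp add: mult_left_le_one_le)
    then have "w \<in> ball z r" by (simp add: r_def dist_norm norm_minus_commute)
    ultimately show ?thesis by (auto simp: G_def)
  qed
  ultimately show False by blast
qed

text \<open>If all 2 x 2 minors vanish, multiplying by \<open>w \<bullet> j\<close> and summing over
  \<open>j\<close> yields u = (u \<bullet> w) w, so \<open>u\<close> is \<open>w\<close> or
  \<open>- w\<close>.\<close>

lemma unit_vectors_nonzero_minor:
  fixes u w :: "'a::euclidean_space"
  assumes "norm u = 1" "norm w = 1" "u \<noteq> w" "u \<noteq> - w"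
  shows "\<exists>i\<in>Basis. \<exists>j\<in>Basis. (u \<bullet> i) * (w \<bullet> j) \<noteq> (u \<bullet> j) * (w \<bullet> i)"
proof (rule ccontr)
  assume "\<not> ?thesis"
  then have minors: "(u \<bullet> i) * (w \<bullet> j) = (u \<bullet> j) * (w \<bullet> i)" if "i \<in> Basis" "j \<in> Basis" for i j
    using that by blast
  have "u = (u \<bullet> w) *\<^sub>R w"
  proof (rule euclidean_eqI)
    fix i :: 'a assume i: "i \<in> Basis"
    have "u \<bullet> i = (u \<bullet> i) * (w \<bullet> w)" using assms by (simp add: norm_eq_1)
    also have "\<dots> = (\<Sum>j\<in>Basis. (u \<bullet> i) * (w \<bullet> j) * (w \<bullet> j))"
      by (subst euclidean_inner) (simp add: sum_distrib_left mult.assoc)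
    also have "\<dots> = (\<Sum>j\<in>Basis. (u \<bullet> j) * (w \<bullet> i) * (w \<bullet> j))"
      using i minors by (intro sum.cong) auto
    also have "\<dots> = (u \<bullet> w) * (w \<bullet> i)"
      by (subst euclidean_inner[of u w]) (simp add: sum_distrib_left ac_simps)
    finally show "u \<bullet> i = ((u \<bullet> w) *\<^sub>R w) \<bullet> i" by simp
  qed
  then have "\<bar>u \<bullet> w\<bar> = 1" using assms by (metis norm_scaleR mult.right_neutral)
  then have "u \<bullet> w = 1 \<or> u \<bullet> w = -1" by linarith
  then show False using \<open>u = (u \<bullet> w) *\<^sub>R w\<close> assms by (metis scaleR_minus1_left scaleR_one)
qed

text \<open>The obtuse-angle criterion for the metric projection, from expanding the squared norm of
  (y - x) - (z - x).\<close>

lemma closest_point_eqI: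
  fixes x y :: "'a::euclidean_space"
  assumes "convex K" "closed K" "x \<in> K" and obtuse: "\<And>z. z \<in> K \<Longrightarrow> (y - x) \<bullet> (z - x) \<le> 0"
  shows "closest_point K y = x"
proof (rule sym, rule closest_point_unique[OF assms(1-3)], intro ballI)
  fix z assume "z \<in> K"
  have "(y - z) \<bullet> (y - z) = (y - x) \<bullet> (y - x) + (z - x) \<bullet> (z - x) - 2 * ((y - x) \<bullet> (z - x))"
    by (simp add: algebra_simps inner_commute)
  also have "\<dots> \<ge> (y - x) \<bullet> (y - x)" using obtuse[OF \<open>z \<in> K\<close>] inner_ge_zero[of "z - x"] by linarith
  finally show "dist y x \<le> dist y z" by (simp add: dist_norm norm_le)
qed

text \<open>Opposite normals at one point would squeeze \<open>K\<close> into a hyperplane, against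
  its nonempty interior.\<close>

lemma outer_unit_normals_not_opposite:
  assumes "convex_body K" "outer_unit_normal K x u" "outer_unit_normal K x w"
  shows "u \<noteq> - w"
proof
  assume uw: "u = - w"
  have K: "K \<subseteq> {y. w \<bullet> y = w \<bullet> x}"
    using assms(2,3) by (force simp: outer_unit_normal_def uw inner_commute intro: antisym)
  have "w \<noteq> 0" using assms(3) by (auto simp: outer_unit_normal_def)
  then have "interior {y. w \<bullet> y = w \<bullet> x} = {}" by simp
  then show False using interior_mono[OF K] assms(1) by (simp add: convex_body_def)
qed

text \<open>At a point with two distinct normals \<open>u\<close>, \<open>w\<close> the normal cone contains a plane sector, which
  meets a codimension-two flat given by two rational coordinates. The metric projection, which is
  nonexpansive, maps such an intersection point back to the given boundary point.\<close>

lemma singular_boundary_points_hausdorff_null: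
  fixes K :: "'a::euclidean_space set"
  assumes K: "convex_body K"
  shows "hausdorff_measure (DIM('a) - 1)
     {x \<in> K. \<exists>u w. u \<noteq> w \<and> outer_unit_normal K x u \<and> outer_unit_normal K x w} = 0" (is "hausdorff_measure _ ?A = 0")
proof -
  have cK: "convex K" and clK: "closed K" and neK: "K \<noteq> {}"
    using K by (auto simp: convex_body_def compact_imp_closed)
  define I where "I = {(i::'a, j::'a, p::real, q::real). i \<in> Basis \<and> j \<in> Basis \<and> i \<noteq> j \<and> p \<in> \<rat> \<and> q \<in> \<rat>}"
  define S where "S = (\<lambda>(i, j, p, q). closest_point K ` {y. y \<bullet> i = p \<and> y \<bullet> j = q})"
  have "I \<subseteq> Basis \<times> Basis \<times> \<rat> \<times> \<rat>" by (auto simp: I_def)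
  moreover have "countable (Basis \<times> Basis \<times> \<rat> \<times> \<rat> :: ('a \<times> 'a \<times> real \<times> real) set)"
    by (intro countable_SIGMA countable_finite countable_rat) auto
  ultimately have "countable I" by (rule countable_subset)
  moreover have "hausdorff_measure (DIM('a) - 1) (S k) = 0" if k: "k \<in> I" for k
  proof -
    obtain i j p q where k_eq: "k = (i, j, p, q)" and "i \<in> Basis" "j \<in> Basis" "i \<noteq> j"
      using k unfolding I_def by blast
    then show ?thesis
      unfolding k_eq S_def case_prod_conv
      by (intro hausdorff_measure_0_nonexpansive_image_flat closest_point_lipschitz cK clK neK)
  qed
  ultimately have "hausdorff_measure (DIM('a) - 1) (\<Union>k\<in>I. S k) = 0"
    by (intro hausdorff_measure_0_UN)
  moreover have "?A \<subseteq> (\<Union>k\<in>I. S k)"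
  proof
    fix x assume "x \<in> ?A"
    then obtain u w where x: "x \<in> K" "u \<noteq> w" and u: "outer_unit_normal K x u" and w: "outer_unit_normal K x w"
      by blast
    have norms: "norm u = 1" "norm w = 1" using u w by (auto simp: outer_unit_normal_def)
    obtain i j where ij: "i \<in> Basis" "j \<in> Basis" "(u \<bullet> i) * (w \<bullet> j) \<noteq> (u \<bullet> j) * (w \<bullet> i)"
      using unit_vectors_nonzero_minor[OF norms \<open>u \<noteq> w\<close> outer_unit_normals_not_opposite[OF K u w]] by blast
    then have "i \<noteq> j" by auto
    define D where "D = (u \<bullet> i) * (w \<bullet> j) - (u \<bullet> j) * (w \<bullet> i)"
    have D: "D \<noteq> 0" using ij by (simp add: D_def)
    \<comment> \<open>The target is near x + u + w, an inner point of the sector. Rational errors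
      below |D|/2 change each of its two coefficients by less than 1, so both remain
      positive.\<close>
    define e where "e = \<bar>D\<bar> / 2"
    have "e > 0" using D by (simp add: e_def)
    obtain p where p: "p \<in> \<rat>" "\<bar>p - (x + u + w) \<bullet> i\<bar> < e"
      using Rats_dense_in_real[of "(x + u + w) \<bullet> i - e" "(x + u + w) \<bullet> i + e"] \<open>e > 0\<close>
      by (auto simp: abs_less_iff)
    obtain q where q: "q \<in> \<rat>" "\<bar>q - (x + u + w) \<bullet> j\<bar> < e"
      using Rats_dense_in_real[of "(x + u + w) \<bullet> j - e" "(x + u + w) \<bullet> j + e"] \<open>e > 0\<close>
      by (auto simp: abs_less_iff)
    define \<alpha> where "\<alpha> = p - (x + u + w) \<bullet> i"
    define \<beta> where "\<beta> = q - (x + u + w) \<bullet> j"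
    \<comment> \<open>Cramer's rule: \<open>a\<close> and \<open>b\<close> are the coefficients for
      which x + a u + b w has i-th coordinate \<open>p\<close> and j-th coordinate
      \<open>q\<close>.\<close>
    define a where "a = 1 + (\<alpha> * (w \<bullet> j) - \<beta> * (w \<bullet> i)) / D"
    define b where "b = 1 + (\<beta> * (u \<bullet> i) - \<alpha> * (u \<bullet> j)) / D"
    have small: "1 + (s * c - t * d) / D > 0" if "\<bar>s\<bar> < e" "\<bar>t\<bar> < e" "\<bar>c\<bar> \<le> 1" "\<bar>d\<bar> \<le> 1" for s t c d
    proof -
      have "\<bar>s * c - t * d\<bar> \<le> \<bar>s\<bar> * \<bar>c\<bar> + \<bar>t\<bar> * \<bar>d\<bar>" by (simp add: abs_mult[symmetric])
      also have "\<dots> \<le> \<bar>s\<bar> * 1 + \<bar>t\<bar> * 1" using that by (intro add_mono mult_left_mono) auto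
      also have "\<dots> < \<bar>D\<bar>" using that by (simp add: e_def)
      finally have "\<bar>(s * c - t * d) / D\<bar> < 1" using D by simp
      then show ?thesis by linarith
    qed
    have coord: "\<bar>v \<bullet> k\<bar> \<le> 1" if "norm v = 1" "k \<in> Basis" for v k :: 'a
      using Basis_le_norm[OF that(2), of v] that(1) by simp
    have "a > 0" "b > 0" unfolding a_def b_def
      by (rule small; use p q coord norms ij in \<open>simp add: \<alpha>_def \<beta>_def\<close>)+
    define y where "y = x + a *\<^sub>R u + b *\<^sub>R w"
    have y_coord: "y \<bullet> k = (x + u + w) \<bullet> k +
        ((\<alpha> * (w \<bullet> j) - \<beta> * (w \<bullet> i)) * (u \<bullet> k) + (\<beta> * (u \<bullet> i) - \<alpha> * (u \<bullet> j)) * (w \<bullet> k)) / D" for k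
      by (simp add: y_def a_def b_def inner_add_left add_divide_distrib distrib_right)
    have "(\<alpha> * (w \<bullet> j) - \<beta> * (w \<bullet> i)) * (u \<bullet> i) + (\<beta> * (u \<bullet> i) - \<alpha> * (u \<bullet> j)) * (w \<bullet> i) = \<alpha> * D"
      "(\<alpha> * (w \<bullet> j) - \<beta> * (w \<bullet> i)) * (u \<bullet> j) + (\<beta> * (u \<bullet> i) - \<alpha> * (u \<bullet> j)) * (w \<bullet> j) = \<beta> * D"
      by (simp_all add: D_def algebra_simps)
    then have yij: "y \<bullet> i = p" "y \<bullet> j = q" using D by (simp_all add: y_coord \<alpha>_def \<beta>_def)
    have "(y - x) \<bullet> (z - x) \<le> 0" if "z \<in> K" for z
    proof -
      have "u \<bullet> (z - x) \<le> 0" "w \<bullet> (z - x) \<le> 0"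
        using u w that by (auto simp: outer_unit_normal_def inner_diff_right inner_commute)
      then show ?thesis using \<open>a > 0\<close> \<open>b > 0\<close>
        by (simp add: y_def inner_add_left add_nonpos_nonpos mult_nonneg_nonpos)
    qed
    then have "closest_point K y = x" by (intro closest_point_eqI cK clK x(1)) auto
    then have "x \<in> S (i, j, p, q)" using yij by (auto simp: S_def)
    moreover have "(i, j, p, q) \<in> I" using ij(1,2) \<open>i \<noteq> j\<close> p q by (simp add: I_def)
    ultimately show "x \<in> (\<Union>k\<in>I. S k)" by blast
  qed
  ultimately show ?thesis by (rule hausdorff_measure_0_subset)
qed

text \<open>Points outside \<open>K\<close> converging to \<open>x\<close> are each separated from
  \<open>K\<close> by some direction in \<open>C\<close>. By compactness a subsequence of these
  directions converges in \<open>C\<close>, and the separating inequalities pass to the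
  limit.\<close>

lemma outer_unit_normal_in_generating_set:
  fixes K :: "'a::euclidean_space set"
  assumes "compact C" and C: "C \<subseteq> sphere 0 1" and hull: "normal_hull K C = K" and "x \<in> frontier K"
  obtains w where "w \<in> C" "outer_unit_normal K x w"
proof -
  have "\<exists>x'. x' \<notin> K \<and> dist x x' < 1 / Suc n" for n
    using \<open>x \<in> frontier K\<close> unfolding frontier_straddle by (meson divide_pos_pos of_nat_0_less_iff zero_less_Suc zero_less_one)
  then obtain X where X: "\<And>n. X n \<notin> K" "\<And>n. dist x (X n) < 1 / Suc n" by metis
  have "\<exists>v\<in>C. \<forall>y\<in>K. y \<bullet> v < X n \<bullet> v" for n
  proof -
    have "X n \<notin> normal_hull K C" using X(1) hull by simp
    then show ?thesis by (auto simp: normal_hull_def not_le)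
  qed
  then obtain v where v: "\<And>n. v n \<in> C" "\<And>n y. y \<in> K \<Longrightarrow> y \<bullet> v n < X n \<bullet> v n" by metis
  obtain w r where w: "w \<in> C" "strict_mono r" "(v \<circ> r) \<longlonglongrightarrow> w"
    using \<open>compact C\<close> v(1) unfolding compact_def by metis
  have "X \<longlonglongrightarrow> x"
  proof (rule metric_LIMSEQ_I)
    fix e :: real assume "e > 0"
    then obtain N where N: "inverse (real (Suc N)) < e" using reals_Archimedean by blast
    have "dist (X n) x < e" if "n \<ge> N" for n
    proof -
      have "1 / real (Suc n) \<le> inverse (real (Suc N))" using that by (simp add: field_simps)
      then show ?thesis using X(2)[of n] N by (simp add: dist_commute)
    qed
    then show "\<exists>N. \<forall>n\<ge>N. dist (X n) x < e" by blast
  qed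
  then have "(X \<circ> r) \<longlonglongrightarrow> x" using w(2) by (rule LIMSEQ_subseq_LIMSEQ)
  have "y \<bullet> w \<le> x \<bullet> w" if "y \<in> K" for y
  proof (rule LIMSEQ_le)
    show "(\<lambda>n. y \<bullet> (v \<circ> r) n) \<longlonglongrightarrow> y \<bullet> w" by (intro tendsto_intros w)
    show "(\<lambda>n. (X \<circ> r) n \<bullet> (v \<circ> r) n) \<longlonglongrightarrow> x \<bullet> w" by (intro tendsto_intros w) fact
    show "\<exists>N. \<forall>n\<ge>N. y \<bullet> (v \<circ> r) n \<le> (X \<circ> r) n \<bullet> (v \<circ> r) n"
      using v(2)[OF that] by (auto intro: less_imp_le)
  qed
  then have "outer_unit_normal K x w" using w(1) C by (auto simp: outer_unit_normal_def)
  with w(1) show thesis by (rule that)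
qed

text \<open>A normal in \<open>U\<close> and a normal from the compact complement of
  \<open>U\<close> are necessarily distinct, so all boundary points in question are
  singular.\<close>

lemma surface_area_measure_0_of_normal_hull:
  fixes K :: "'a::euclidean_space set"
  assumes K: "convex_body K" and U: "openin (top_of_set (sphere 0 1)) U"
    and hull: "normal_hull K (sphere 0 1 - U) = K"
  shows "surface_area_measure K U = 0"
proof -
  have "compact (sphere (0::'a) 1 - U)"
    using U closedin_compact[of "sphere 0 1" "sphere 0 1 - U"] by (simp add: closedin_diff)
  have "{x \<in> frontier K. \<exists>u\<in>U. outer_unit_normal K x u} \<subseteq>
     {x \<in> K. \<exists>u w. u \<noteq> w \<and> outer_unit_normal K x u \<and> outer_unit_normal K x w}"
  proof
    fix x assume "x \<in> {x \<in> frontier K. \<exists>u\<in>U. outer_unit_normal K x u}"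
    then obtain u where x: "x \<in> frontier K" and u: "u \<in> U" "outer_unit_normal K x u" by blast
    obtain w where w: "w \<in> sphere 0 1 - U" "outer_unit_normal K x w"
      by (rule outer_unit_normal_in_generating_set[OF \<open>compact (sphere 0 1 - U)\<close> _ hull x]) auto
    have "x \<in> K" using x K frontier_subset_closed[of K] by (auto simp: convex_body_def compact_imp_closed)
    moreover have "u \<noteq> w" using u w by auto
    ultimately show "x \<in> {x \<in> K. \<exists>u w. u \<noteq> w \<and> outer_unit_normal K x u \<and> outer_unit_normal K x w}"
      using u w by blast
  qed
  then show ?thesis
    unfolding surface_area_measure_def
    by (rule hausdorff_measure_0_subset[OF singular_boundary_points_hausdorff_null[OF K]])
qed


section \<open>Measures of sets of hyperplanes\<close>

lemma hyperplane_eq_iff: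
  fixes u v :: "'a::euclidean_space"
  assumes "norm u = 1" "norm v = 1"
  shows "hyperplane u t = hyperplane v s \<longleftrightarrow> (v = u \<and> s = t) \<or> (v = - u \<and> s = - t)"
proof
  assume eq: "hyperplane u t = hyperplane v s"
  have uv: "u \<bullet> u = 1" "v \<bullet> v = 1" using assms by (simp_all add: norm_eq_1)
  \<comment> \<open>Two points of H(u,t) are tested in H(v,s): the foot t u of the origin, and its
    shift by the part of \<open>v\<close> orthogonal to \<open>u\<close>. They yield t c = s and c^2
    = 1.\<close>
  define c where "c = u \<bullet> v"
  have "t *\<^sub>R u \<in> hyperplane v s" "t *\<^sub>R u + (v - c *\<^sub>R u) \<in> hyperplane v s"
    unfolding eq[symmetric] by (simp_all add: hyperplane_def inner_add_left inner_diff_left uv c_def inner_commute[of v u])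
  then have ts: "t * c = s" and "c * c = 1"
    by (simp_all add: hyperplane_def inner_add_left inner_diff_left uv c_def)
  then have "c = 1 \<or> c = -1" by (simp add: square_eq_1_iff)
  then show "(v = u \<and> s = t) \<or> (v = - u \<and> s = - t)"
  proof
    assume "c = 1"
    then have "(v - u) \<bullet> (v - u) = 0" by (simp add: inner_diff_left inner_diff_right uv c_def inner_commute[of v u])
    then show ?thesis using ts \<open>c = 1\<close> by simp
  next
    assume "c = -1"
    then have "(v + u) \<bullet> (v + u) = 0" by (simp add: inner_add_left inner_add_right uv c_def inner_commute[of v u])
    then have "v = - u" by (simp add: eq_neg_iff_add_eq_0)
    then show ?thesis using ts \<open>c = -1\<close> by simp
  qed
qed (auto simp: hyperplane_def)

text \<open>Parameter sets live in the full product space, so that openness is ordinary openness.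
  They need not be symmetric under (u,t) -> (-u,-t); the symmetrisation appears in the membership
  criterion.\<close>

definition hyperplanes_of :: "('a::euclidean_space \<times> real) set \<Rightarrow> 'a set set" where
  "hyperplanes_of W = {hyperplane u t | u t. norm u = 1 \<and> (u, t) \<in> W}"

lemma hyperplanes_ofI: "norm u = 1 \<Longrightarrow> (u, t) \<in> W \<Longrightarrow> hyperplane u t \<in> hyperplanes_of W"
  unfolding hyperplanes_of_def by blast

lemma hyperplane_mem_hyperplanes_of_iff:
  assumes "norm u = 1"
  shows "hyperplane u t \<in> hyperplanes_of W \<longleftrightarrow> (u, t) \<in> W \<or> (- u, - t) \<in> W"
proof
  assume "hyperplane u t \<in> hyperplanes_of W"
  then obtain v s where v: "norm v = 1" "(v, s) \<in> W" "hyperplane u t = hyperplane v s"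
    by (auto simp: hyperplanes_of_def)
  then show "(u, t) \<in> W \<or> (- u, - t) \<in> W"
    using hyperplane_eq_iff[OF assms v(1)] by auto
next
  have eq: "hyperplane u t = hyperplane (- u) (- t)" by (simp add: hyperplane_eq_iff assms)
  assume "(u, t) \<in> W \<or> (- u, - t) \<in> W"
  then show "hyperplane u t \<in> hyperplanes_of W"
  proof
    assume "(- u, - t) \<in> W"
    then show ?thesis unfolding eq using assms by (intro hyperplanes_ofI) auto
  qed (intro hyperplanes_ofI assms)
qed

lemma openin_hyperplanes_of:
  assumes "open W"
  shows "openin hyperplane_topology (hyperplanes_of W)"
proof -
  have "{(u, t). norm u = 1 \<and> hyperplane u t \<in> hyperplanes_of W} = (sphere 0 1 \<times> UNIV) \<inter> (W \<union> uminus -` W)"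
    by (auto simp: hyperplane_mem_hyperplanes_of_iff)
  moreover have "open (uminus -` W)" by (intro open_vimage assms continuous_intros)
  ultimately show ?thesis
    using assms by (auto simp: openin_hyperplane_topology hyperplanes_of_def hyperplanes_def openin_open intro!: open_Un)
qed

lemma openin_hyperplane_topology_sets:
  assumes "openin hyperplane_topology U"
  shows "U \<in> sets hyperplane_borel"
proof -
  have "{U. openin hyperplane_topology U} \<subseteq> Pow hyperplanes" by (auto simp: openin_hyperplane_topology)
  then show ?thesis unfolding hyperplane_borel_def using assms by (intro in_measure_of) auto
qed

section \<open>Values of the hyperplane measure on open parameter sets\<close>

lemma space_directional_distribution:
  assumes "directional_distribution \<phi>"
  shows "space \<phi> = sphere 0 1"
  using assms sets_eq_imp_space_eq[of \<phi>] by (simp add: directional_distribution_def space_restrict_space)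

lemma open_Int_sphere_sets_directional_distribution:
  fixes \<phi> :: "'a::euclidean_space measure"
  assumes "directional_distribution \<phi>" "open U"
  shows "sphere 0 1 \<inter> U \<in> sets \<phi>"
  using assms by (simp add: directional_distribution_def sets_restrict_space)

lemma emeasure_directional_distribution_uminus:
  fixes \<phi> :: "'a::euclidean_space measure"
  assumes \<phi>: "directional_distribution \<phi>" and U: "open U"
  shows "emeasure \<phi> (sphere 0 1 \<inter> uminus ` U) = emeasure \<phi> (sphere 0 1 \<inter> U)"
proof -
  have "uminus ` (sphere 0 1 \<inter> U) = sphere 0 1 \<inter> uminus ` U" by force
  moreover have "even_measure \<phi>" using \<phi> by (simp add: directional_distribution_def)
  then have "emeasure \<phi> (uminus ` (sphere 0 1 \<inter> U)) = emeasure \<phi> (sphere 0 1 \<inter> U)"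
    using open_Int_sphere_sets_directional_distribution[OF \<phi> U] unfolding even_measure_def by blast
  ultimately show ?thesis by simp
qed

text \<open>The intensity integrates over t \<ge> 0 only, so a hyperplane given by \<open>W\<close>
  with negative \<open>t\<close> is counted through its reflected parameters.\<close>

lemma emeasure_hyperplane_measure_hyperplanes_of:
  assumes \<phi>: "directional_distribution \<phi>" and W: "open W"
  shows "emeasure (hyperplane_measure \<phi> 1) (hyperplanes_of W) =
    2 * (\<integral>\<^sup>+u. (\<integral>\<^sup>+t\<in>{0..}. indicator (W \<union> uminus -` W) (u, t) \<partial>lborel) \<partial>\<phi>)"
proof -
  have "sets \<phi> = sets (restrict_space borel (sphere 0 1))"
    using \<phi> by (simp add: directional_distribution_def)
  moreover have "hyperplanes_of W \<in> sets hyperplane_borel"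
    by (intro openin_hyperplane_topology_sets openin_hyperplanes_of W)
  moreover have "(\<integral>\<^sup>+u. (\<integral>\<^sup>+t\<in>{0..}. indicator (hyperplanes_of W) (hyperplane u t) \<partial>lborel) \<partial>\<phi>) =
     (\<integral>\<^sup>+u. (\<integral>\<^sup>+t\<in>{0..}. indicator (W \<union> uminus -` W) (u, t) \<partial>lborel) \<partial>\<phi>)"
    using space_directional_distribution[OF \<phi>]
    by (intro nn_integral_cong) (auto simp: indicator_def hyperplane_mem_hyperplanes_of_iff)
  ultimately show ?thesis
    by (simp add: emeasure_hyperplane_measure)
qed

lemma emeasure_hyperplane_measure_finite:
  assumes \<phi>: "directional_distribution \<phi>" and W: "open W" and bnd: "\<And>u t. (u, t) \<in> W \<Longrightarrow> \<bar>t\<bar> \<le> c"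
  shows "emeasure (hyperplane_measure \<phi> 1) (hyperplanes_of W) < \<infinity>"
proof -
  interpret prob_space \<phi> using \<phi> by (simp add: directional_distribution_def)
  have "(\<integral>\<^sup>+u. (\<integral>\<^sup>+t\<in>{0..}. indicator (W \<union> uminus -` W) (u, t) \<partial>lborel) \<partial>\<phi>) \<le>
     (\<integral>\<^sup>+u. (\<integral>\<^sup>+t. indicator {0..\<bar>c\<bar>} t \<partial>lborel) \<partial>\<phi>)"
    using bnd by (intro nn_integral_mono) (force simp: indicator_def)
  also have "\<dots> = ennreal \<bar>c\<bar>" by (simp add: emeasure_space_1)
  also have "\<dots> < top" by simp
  finally show ?thesis
    by (simp add: emeasure_hyperplane_measure_hyperplanes_of[OF \<phi> W] ennreal_mult_less_top)
qed

text \<open>Hyperplanes with normal in \<open>U\<close> and negative \<open>t\<close> are counted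
  under the direction in -U; evenness of \<open>\<phi>\<close> makes these directions null
  too.\<close>

lemma emeasure_hyperplane_measure_null_directions:
  fixes \<phi> :: "'a::euclidean_space measure"
  assumes \<phi>: "directional_distribution \<phi>" and U: "open U" and null: "emeasure \<phi> (sphere 0 1 \<inter> U) = 0"
  shows "emeasure (hyperplane_measure \<phi> 1) (hyperplanes_of (U \<times> UNIV)) = 0"
proof -
  have "open (uminus ` U)" using U by (rule open_negations)
  then have "sphere 0 1 \<inter> U \<in> null_sets \<phi>" "sphere 0 1 \<inter> uminus ` U \<in> null_sets \<phi>"
    using null emeasure_directional_distribution_uminus[OF \<phi> U]
      open_Int_sphere_sets_directional_distribution[OF \<phi>] U by (auto simp: null_sets_def)
  then have "AE u in \<phi>. u \<notin> sphere 0 1 \<inter> U" "AE u in \<phi>. u \<notin> sphere 0 1 \<inter> uminus ` U"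
    by (blast intro: AE_not_in)+
  then have "AE u in \<phi>. (\<integral>\<^sup>+t\<in>{0..}. indicator (U \<times> UNIV \<union> uminus -` (U \<times> UNIV)) (u, t) \<partial>lborel) = 0"
    using AE_space
  proof eventually_elim
    case (elim u)
    then have "u \<notin> U" "- u \<notin> U"
      using space_directional_distribution[OF \<phi>] by (auto, metis image_eqI minus_minus)
    then show ?case by simp
  qed
  then have "(\<integral>\<^sup>+u. (\<integral>\<^sup>+t\<in>{0..}. indicator (U \<times> UNIV \<union> uminus -` (U \<times> UNIV)) (u, t) \<partial>lborel) \<partial>\<phi>) = (\<integral>\<^sup>+u. 0 \<partial>\<phi>)"
    by (rule nn_integral_cong_AE)
  then show ?thesis
    using emeasure_hyperplane_measure_hyperplanes_of[OF \<phi>, of "U \<times> UNIV"] U by (simp add: open_Times)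
qed

text \<open>If the interval reaches positive values it is cut at 0. Otherwise directions and
  interval are reflected together, and evenness of \<open>\<phi>\<close> preserves the positive
  mass.\<close>

lemma emeasure_hyperplane_measure_pos:
  fixes \<phi> :: "'a::euclidean_space measure"
  assumes \<phi>: "directional_distribution \<phi>" and U: "open U" and pos: "emeasure \<phi> (sphere 0 1 \<inter> U) > 0"
    and "a < b"
  shows "emeasure (hyperplane_measure \<phi> 1) (hyperplanes_of (U \<times> {a<..<b})) > 0"
proof -
  have nonneg: "emeasure (hyperplane_measure \<phi> 1) (hyperplanes_of (U \<times> {a<..<b})) > 0"
    if U: "open U" and pos: "emeasure \<phi> (sphere 0 1 \<inter> U) > 0" and ab: "0 \<le> a" "a < b" for U and a b :: real
  proof -
    let ?W = "U \<times> {a<..<b}"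
    have "0 < emeasure \<phi> (sphere 0 1 \<inter> U) * ennreal (b - a)"
      using pos ab by (simp add: ennreal_zero_less_mult_iff)
    also have "\<dots> = (\<integral>\<^sup>+u. ennreal (b - a) * indicator (sphere 0 1 \<inter> U) u \<partial>\<phi>)"
      using open_Int_sphere_sets_directional_distribution[OF \<phi> U]
      by (subst nn_integral_cmult_indicator) (auto simp: mult.commute)
    also have "\<dots> \<le> (\<integral>\<^sup>+u. (\<integral>\<^sup>+t\<in>{0..}. indicator (?W \<union> uminus -` ?W) (u, t) \<partial>lborel) \<partial>\<phi>)"
    proof (rule nn_integral_mono)
      fix u
      show "ennreal (b - a) * indicator (sphere 0 1 \<inter> U) u \<le>
         (\<integral>\<^sup>+t\<in>{0..}. indicator (?W \<union> uminus -` ?W) (u, t) \<partial>lborel)"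
      proof (cases "u \<in> sphere 0 1 \<inter> U")
        case True
        have "ennreal (b - a) = (\<integral>\<^sup>+t. indicator {a<..<b} t \<partial>lborel)"
          using ab by simp
        also have "\<dots> \<le> (\<integral>\<^sup>+t\<in>{0..}. indicator (?W \<union> uminus -` ?W) (u, t) \<partial>lborel)"
          using True ab by (intro nn_integral_mono) (auto simp: indicator_def)
        finally show ?thesis using True by simp
      qed simp
    qed
    finally show ?thesis
      using emeasure_hyperplane_measure_hyperplanes_of[OF \<phi>, of ?W] U
      by (simp add: open_Times ennreal_zero_less_mult_iff)
  qed
  show ?thesis
  proof (cases "0 < b")
    case True
    have "emeasure (hyperplane_measure \<phi> 1) (hyperplanes_of (U \<times> {max a 0<..<b})) > 0"
      using True \<open>a < b\<close> by (intro nonneg U pos) auto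
    also have "\<dots> \<le> emeasure (hyperplane_measure \<phi> 1) (hyperplanes_of (U \<times> {a<..<b}))"
      using openin_hyperplane_topology_sets[OF openin_hyperplanes_of, of "U \<times> {a<..<b}"] U
      by (intro emeasure_mono) (auto simp: hyperplanes_of_def open_Times)
    finally show ?thesis .
  next
    case False
    have "hyperplanes_of (U \<times> {a<..<b}) = hyperplanes_of (uminus ` U \<times> {- b<..<- a})"
    proof -
      have "H \<in> hyperplanes_of (U \<times> {a<..<b}) \<longleftrightarrow> H \<in> hyperplanes_of (uminus ` U \<times> {- b<..<- a})"
        if H: "H \<in> hyperplanes" for H
      proof -
        obtain u t where "H = hyperplane u t" "norm u = 1" using H by (auto simp: hyperplanes_def)
        moreover have "v \<in> uminus ` U \<longleftrightarrow> - v \<in> U" for v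
          by (metis imageE imageI minus_minus)
        ultimately show ?thesis by (auto simp: hyperplane_mem_hyperplanes_of_iff)
      qed
      moreover have "hyperplanes_of W \<subseteq> hyperplanes" for W :: "('a \<times> real) set"
        by (auto simp: hyperplanes_of_def hyperplanes_def)
      ultimately show ?thesis by blast
    qed
    moreover have "emeasure (hyperplane_measure \<phi> 1) (hyperplanes_of (uminus ` U \<times> {- b<..<- a})) > 0"
      using False \<open>a < b\<close> pos emeasure_directional_distribution_uminus[OF \<phi> U]
      by (intro nonneg open_negations U) auto
    ultimately show ?thesis by simp
  qed
qed

text \<open>Required for evaluating the driving intensity on rectangles; the exhausting sets consist
  of the hyperplanes at distance less than n from the origin.\<close>

lemma sigma_finite_hyperplane_measure:
  fixes \<phi> :: "'a::euclidean_space measure"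
  assumes \<phi>: "directional_distribution \<phi>"
  shows "sigma_finite_measure (hyperplane_measure \<phi> 1)"
proof
  let ?S = "\<lambda>n::nat. hyperplanes_of ((UNIV :: 'a set) \<times> {- real n<..<real n})"
  have "open (UNIV \<times> {- real n<..<real n} :: ('a \<times> real) set)" for n
    by (simp add: open_Times)
  note S = this
  have "?S n \<in> sets (hyperplane_measure \<phi> 1)" for n
    using openin_hyperplane_topology_sets[OF openin_hyperplanes_of[OF S]] by simp
  moreover have "emeasure (hyperplane_measure \<phi> 1) (?S n) < \<infinity>" for n
    by (rule emeasure_hyperplane_measure_finite[OF \<phi> S, where c = "real n"]) auto
  then have "emeasure (hyperplane_measure \<phi> 1) (?S n) \<noteq> \<infinity>" for n
    by (metis less_irrefl)
  moreover have "space (hyperplane_measure \<phi> 1) = hyperplanes"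
    using sets_eq_imp_space_eq[OF sets_hyperplane_measure, of \<phi> 1] by simp
  moreover have "(\<Union>n. ?S n) = hyperplanes"
  proof (intro equalityI subsetI)
    fix H :: "'a set" assume "H \<in> hyperplanes"
    then obtain u t where H: "H = hyperplane u t" "norm u = 1" by (auto simp: hyperplanes_def)
    obtain n :: nat where "\<bar>t\<bar> < real n" using reals_Archimedean2 by blast
    then have "H \<in> ?S n" using H by (auto simp: hyperplane_mem_hyperplanes_of_iff)
    then show "H \<in> (\<Union>n. ?S n)" by blast
  qed (auto simp: hyperplanes_of_def hyperplanes_def)
  ultimately show "\<exists>A. countable A \<and> A \<subseteq> sets (hyperplane_measure \<phi> 1) \<and>
      \<Union> A = space (hyperplane_measure \<phi> 1) \<and> (\<forall>a\<in>A. emeasure (hyperplane_measure \<phi> 1) a \<noteq> \<infinity>)"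
    by (intro exI[of _ "range ?S"]) auto
qed


section \<open>Poisson hyperplane processes\<close>

text \<open>The property is pulled back along (u,t) -> H(u,t) to the product of sphere and line,
  which is second countable.\<close>

lemma Lindelof_hyperplane_topology:
  fixes \<U> :: "'a::euclidean_space set set set"
  assumes "\<And>U. U \<in> \<U> \<Longrightarrow> openin hyperplane_topology U"
  obtains \<V> where "\<V> \<subseteq> \<U>" "countable \<V>" "\<Union>\<V> = \<Union>\<U>"
proof -
  define pre where "pre U = {(u::'a, t). norm u = 1 \<and> hyperplane u t \<in> U}" for U
  have "openin (top_of_set (sphere 0 1 \<times> UNIV)) S" if "S \<in> pre ` \<U>" for S
    using that assms unfolding pre_def by (auto simp: openin_hyperplane_topology)
  then obtain \<F> where F: "\<F> \<subseteq> pre ` \<U>" "countable \<F>" "\<Union>\<F> = \<Union>(pre ` \<U>)"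
    by (rule Lindelof_openin)
  obtain \<V> where V: "\<V> \<subseteq> \<U>" "countable \<V>" "\<F> = pre ` \<V>"
    using F(1,2) by (metis countable_subset_image)
  have "\<Union>\<U> \<subseteq> \<Union>\<V>"
  proof
    fix H assume "H \<in> \<Union>\<U>"
    then obtain U where U: "U \<in> \<U>" "H \<in> U" by blast
    then obtain u t where H: "H = hyperplane u t" "norm u = 1"
      using assms[OF U(1)] by (auto simp: openin_hyperplane_topology hyperplanes_def)
    then have "(u, t) \<in> \<Union>(pre ` \<U>)" using U by (auto simp: pre_def)
    then have "(u, t) \<in> \<Union>(pre ` \<V>)" using F(3) V(3) by simp
    then show "H \<in> \<Union>\<V>" using H by (auto simp: pre_def)
  qed
  then show thesis using V(1,2) by (intro that) blast+
qed

text \<open>If the support missed \<open>B\<close>, every hyperplane in \<open>B\<close> would have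
  an open neighbourhood of mass zero, and countably many of these would cover
  \<open>B\<close>.\<close>

lemma support_hyperplane_process_meets:
  fixes \<xi> :: "'w \<Rightarrow> (real \<times> 'a::euclidean_space set) measure"
  assumes sets: "\<And>U. openin hyperplane_topology U \<Longrightarrow> {0..\<gamma>} \<times> U \<in> sets (\<xi> \<omega>)"
    and B: "openin hyperplane_topology B" and pos: "emeasure (\<xi> \<omega>) ({0..\<gamma>} \<times> B) > 0"
  shows "\<exists>H\<in>B. H \<in> support hyperplane_topology (hyperplane_process \<xi> \<gamma> \<omega>)"
proof (rule ccontr)
  assume neg: "\<not> ?thesis"
  define \<U> where "\<U> = {U. openin hyperplane_topology U \<and> emeasure (\<xi> \<omega>) ({0..\<gamma>} \<times> U) = 0}"
  obtain \<V> where V: "\<V> \<subseteq> \<U>" "countable \<V>" "\<Union>\<V> = \<Union>\<U>"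
    by (rule Lindelof_hyperplane_topology[of \<U>]) (auto simp: \<U>_def)
  have "B \<subseteq> \<Union>\<U>"
  proof
    fix H assume "H \<in> B"
    then have "H \<in> topspace hyperplane_topology" "H \<notin> support hyperplane_topology (hyperplane_process \<xi> \<gamma> \<omega>)"
      using neg B openin_subset by blast+
    then show "H \<in> \<Union>\<U>"
      by (auto simp: support_def hyperplane_process_def \<U>_def)
  qed
  then have "{0..\<gamma>} \<times> B \<subseteq> (\<Union>U\<in>\<V>. {0..\<gamma>} \<times> U)" using V(3) by blast
  moreover have "(\<Union>U\<in>\<V>. {0..\<gamma>} \<times> U) \<in> null_sets (\<xi> \<omega>)"
    using V(1,2) sets by (intro null_sets_UN') (auto simp: \<U>_def null_sets_def)
  ultimately have "{0..\<gamma>} \<times> B \<in> null_sets (\<xi> \<omega>)"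
    using sets[OF B] by (rule null_sets_subset[rotated 2])
  then show False using pos by (simp add: null_sets_def)
qed

lemma support_hyperplane_process_avoids:
  assumes "openin hyperplane_topology B" "emeasure (\<xi> \<omega>) ({0..\<gamma>} \<times> B) = 0"
  shows "support hyperplane_topology (hyperplane_process \<xi> \<gamma> \<omega>) \<inter> B = {}"
  using assms by (auto simp: support_def hyperplane_process_def)

section \<open>Void probabilities of the driving process\<close>

context
  fixes \<phi> :: "'a::euclidean_space measure" and M :: "'w measure"
    and \<xi> :: "'w \<Rightarrow> (real \<times> 'a set) measure"
  assumes \<phi>: "directional_distribution \<phi>" and M: "prob_space M"
    and \<xi>: "hyperplane_driving_process M \<phi> \<xi>"
begin

interpretation prob_space M by (rule M)

abbreviation driving_intensity :: "(real \<times> 'a set) measure" where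
  "driving_intensity \<equiv> restrict_space lborel {0..} \<Otimes>\<^sub>M hyperplane_measure \<phi> 1"

lemma sets_driving_intensity_Times:
  assumes "B \<in> sets hyperplane_borel"
  shows "{0..\<gamma>} \<times> B \<in> sets driving_intensity"
  using assms by (intro pair_measureI) (auto simp: sets_restrict_space)

lemma emeasure_driving_intensity_Times:
  assumes "B \<in> sets hyperplane_borel" "0 \<le> \<gamma>"
  shows "emeasure driving_intensity ({0..\<gamma>} \<times> B) = ennreal \<gamma> * emeasure (hyperplane_measure \<phi> 1) B"
proof -
  interpret sigma_finite_measure "hyperplane_measure \<phi> 1"
    by (rule sigma_finite_hyperplane_measure[OF \<phi>])
  have "emeasure driving_intensity ({0..\<gamma>} \<times> B) =
     emeasure (restrict_space lborel {0..}) {0..\<gamma>} * emeasure (hyperplane_measure \<phi> 1) B"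
    using assms by (intro emeasure_pair_measure_Times) (auto simp: sets_restrict_space)
  also have "emeasure (restrict_space lborel {0..}) {0..\<gamma>} = ennreal \<gamma>"
    using assms(2) by (subst emeasure_restrict_space) auto
  finally show ?thesis .
qed

lemma sets_driving_process:
  assumes "\<omega> \<in> space M" "openin hyperplane_topology U"
  shows "{0..\<gamma>} \<times> U \<in> sets (\<xi> \<omega>)"
  using \<xi> assms sets_driving_intensity_Times[OF openin_hyperplane_topology_sets]
  unfolding hyperplane_driving_process_def poisson_process_def point_process_def by blast

lemma measurable_emeasure_driving_process:
  assumes "B \<in> sets hyperplane_borel"
  shows "(\<lambda>\<omega>. emeasure (\<xi> \<omega>) ({0..\<gamma>} \<times> B)) \<in> borel_measurable M"
  using \<xi> sets_driving_intensity_Times[OF assms]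
  unfolding hyperplane_driving_process_def poisson_process_def point_process_def by blast

text \<open>The case \<open>k = 0\<close> of the Poisson law. The value decays geometrically along
  integer \<open>\<gamma>\<close> if \<open>B\<close> has positive measure and is 1 if
  \<open>B\<close> is null, which yields the two almost sure statements below.\<close>

lemma prob_driving_process_void:
  assumes B: "B \<in> sets hyperplane_borel" and fin: "emeasure (hyperplane_measure \<phi> 1) B < \<infinity>" and "0 \<le> \<gamma>"
  shows "prob {\<omega> \<in> space M. emeasure (\<xi> \<omega>) ({0..\<gamma>} \<times> B) = 0} =
     exp (- (\<gamma> * measure (hyperplane_measure \<phi> 1) B))"
proof -
  have "emeasure driving_intensity ({0..\<gamma>} \<times> B) < \<infinity>"
    using emeasure_driving_intensity_Times[OF B \<open>0 \<le> \<gamma>\<close>] fin by (simp add: ennreal_mult_less_top)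
  then have "\<forall>k. prob {\<omega> \<in> space M. emeasure (\<xi> \<omega>) ({0..\<gamma>} \<times> B) = of_nat k} =
     measure driving_intensity ({0..\<gamma>} \<times> B) ^ k / fact k * exp (- measure driving_intensity ({0..\<gamma>} \<times> B))"
    using \<xi> sets_driving_intensity_Times[OF B, of \<gamma>]
    unfolding hyperplane_driving_process_def poisson_process_def by blast
  then have "prob {\<omega> \<in> space M. emeasure (\<xi> \<omega>) ({0..\<gamma>} \<times> B) = of_nat 0} =
     measure driving_intensity ({0..\<gamma>} \<times> B) ^ 0 / fact 0 * exp (- measure driving_intensity ({0..\<gamma>} \<times> B))"
    by (rule spec)
  moreover have "measure driving_intensity ({0..\<gamma>} \<times> B) = \<gamma> * measure (hyperplane_measure \<phi> 1) B"
    unfolding measure_def using emeasure_driving_intensity_Times[OF B \<open>0 \<le> \<gamma>\<close>] \<open>0 \<le> \<gamma>\<close>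
    by (simp add: enn2real_mult)
  ultimately show ?thesis by simp
qed

text \<open>Missing \<open>B\<close> at all integer times is contained in missing it at time n,
  which has probability exp(-\<theta>)^n.\<close>

lemma AE_driving_process_hits:
  assumes B: "B \<in> sets hyperplane_borel" and fin: "emeasure (hyperplane_measure \<phi> 1) B < \<infinity>"
    and pos: "emeasure (hyperplane_measure \<phi> 1) B > 0"
  shows "AE \<omega> in M. \<exists>n::nat. emeasure (\<xi> \<omega>) ({0..real n} \<times> B) > 0"
proof -
  define \<theta> where "\<theta> = measure (hyperplane_measure \<phi> 1) B"
  have "\<theta> > 0" using fin pos by (simp add: \<theta>_def measure_def enn2real_positive_iff)
  define E where "E n = {\<omega> \<in> space M. emeasure (\<xi> \<omega>) ({0..real n} \<times> B) = 0}" for n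
  have E[measurable]: "E n \<in> events" for n
    unfolding E_def using measurable_emeasure_driving_process[OF B, of "real n"] by measurable
  have "prob (\<Inter>n. E n) \<le> exp (- \<theta>) ^ n" for n
  proof -
    have "prob (\<Inter>n. E n) \<le> prob (E n)" by (intro finite_measure_mono) auto
    also have "\<dots> = exp (- \<theta>) ^ n"
      unfolding E_def using prob_driving_process_void[OF B fin, of "real n"]
      by (simp add: \<theta>_def exp_of_nat_mult[symmetric])
    finally show ?thesis .
  qed
  moreover have "(\<lambda>n. exp (- \<theta>) ^ n) \<longlonglongrightarrow> 0"
    using \<open>\<theta> > 0\<close> by (intro LIMSEQ_realpow_zero) auto
  ultimately have "prob (\<Inter>n. E n) \<le> 0" by (intro LIMSEQ_le_const) auto
  then have "prob (\<Inter>n. E n) = 0" using measure_nonneg[of M] by (intro antisym)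
  then have "(\<Inter>n. E n) \<in> null_sets M" by (simp add: null_sets_def emeasure_eq_measure)
  then have "AE \<omega> in M. \<omega> \<notin> (\<Inter>n. E n)" by (rule AE_not_in)
  then show ?thesis
    using AE_space by eventually_elim (auto simp: E_def zero_less_iff_neq_zero)
qed

lemma AE_driving_process_avoids:
  assumes B: "B \<in> sets hyperplane_borel" and null: "emeasure (hyperplane_measure \<phi> 1) B = 0"
  shows "AE \<omega> in M. \<forall>n::nat. emeasure (\<xi> \<omega>) ({0..real n} \<times> B) = 0"
  unfolding AE_all_countable
proof
  fix n :: nat
  have "{\<omega> \<in> space M. emeasure (\<xi> \<omega>) ({0..real n} \<times> B) = 0} \<in> events"
    using measurable_emeasure_driving_process[OF B, of "real n"] by measurable
  moreover have "prob {\<omega> \<in> space M. emeasure (\<xi> \<omega>) ({0..real n} \<times> B) = 0} = 1"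
    using prob_driving_process_void[OF B, of "real n"] null by (simp add: measure_def)
  ultimately show "AE \<omega> in M. emeasure (\<xi> \<omega>) ({0..real n} \<times> B) = 0"
    using prob_eq_1 by force
qed

end


section \<open>Convergence of the K-cells\<close>

text \<open>Strict separation of \<open>x\<close> from \<open>K\<close> survives small changes of
  direction and offset. This supplies an open set of hyperplanes, each of which cuts one common ball
  around \<open>x\<close> off from \<open>K\<close>.\<close>

lemma strictly_separating_hyperplanes:
  fixes K :: "'a::euclidean_space set"
  assumes "compact K" "K \<noteq> {}" and x: "\<And>y. y \<in> K \<Longrightarrow> y \<bullet> u < x \<bullet> u"
  obtains U a b \<eta> where "open U" "u \<in> U" "a < b" "\<eta> > 0"
    and "\<And>v t y. v \<in> U \<Longrightarrow> norm v = 1 \<Longrightarrow> a < t \<Longrightarrow> y \<in> K \<Longrightarrow> y \<bullet> v < t"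
    and "\<And>v t y. v \<in> U \<Longrightarrow> norm v = 1 \<Longrightarrow> t < b \<Longrightarrow> y \<in> ball x \<eta> \<Longrightarrow> t < y \<bullet> v"
proof -
  have "continuous_on K (\<lambda>y. y \<bullet> u)" by (intro continuous_intros)
  then obtain y0 where y0: "y0 \<in> K" "\<forall>y\<in>K. y \<bullet> u \<le> y0 \<bullet> u"
    using continuous_attains_sup[OF assms(1,2)] by blast
  \<comment> \<open>The four quarters of the gap pay for tilting \<open>u\<close> on
    \<open>K\<close>, for the slab between \<open>a\<close> and \<open>b\<close>, for the ball
    around \<open>x\<close>, and for tilting \<open>u\<close> at \<open>x\<close>.\<close>
  define g where "g = (x \<bullet> u - y0 \<bullet> u) / 4"
  have g: "g > 0" "x \<bullet> u = y0 \<bullet> u + 4 * g" using x[OF y0(1)] by (simp_all add: g_def field_simps)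
  have "bounded (insert x K)" using compact_imp_bounded[OF assms(1)] by simp
  then obtain R where R: "R > 0" "\<forall>y\<in>insert x K. norm y \<le> R"
    using bounded_pos by blast
  have perturb: "\<bar>y \<bullet> v - y \<bullet> u\<bar> < g" if v: "v \<in> ball u (g / R)" and y: "y \<in> insert x K" for v y
  proof -
    have "\<bar>y \<bullet> v - y \<bullet> u\<bar> = \<bar>y \<bullet> (v - u)\<bar>" by (simp add: inner_diff_right)
    also have "\<dots> \<le> norm y * norm (v - u)" by (rule Cauchy_Schwarz_ineq2)
    also have "\<dots> \<le> R * norm (v - u)" using R y by (intro mult_right_mono) auto
    also have "\<dots> < R * (g / R)" using v R by (intro mult_strict_left_mono) (auto simp: dist_norm norm_minus_commute)
    finally show ?thesis using R by simp
  qed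
  show thesis
  proof (rule that[of "ball u (g / R)" "y0 \<bullet> u + g" "y0 \<bullet> u + 2 * g" g])
    show "open (ball u (g / R))" "u \<in> ball u (g / R)" "y0 \<bullet> u + g < y0 \<bullet> u + 2 * g" "g > 0"
      using g R by auto
  next
    fix v t y assume "v \<in> ball u (g / R)" "norm v = 1" "y0 \<bullet> u + g < t" "y \<in> K"
    then show "y \<bullet> v < t"
      using perturb[of v y] y0(2) by force
  next
    fix v t y assume v: "v \<in> ball u (g / R)" "norm v = 1" "t < y0 \<bullet> u + 2 * g" and y: "y \<in> ball x g"
    have "\<bar>(y - x) \<bullet> v\<bar> \<le> norm (y - x) * norm v" by (rule Cauchy_Schwarz_ineq2)
    also have "\<dots> < g" using y v by (simp add: dist_norm norm_minus_commute)
    finally have "\<bar>y \<bullet> v - x \<bullet> v\<bar> < g" by (simp add: inner_diff_left)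
    then show "t < y \<bullet> v"
      using perturb[of v x] v g by auto
  qed
qed

section \<open>Deterministic properties of cells\<close>

lemma subset_cell_of: "K \<subseteq> cell_of X K"
  by (auto simp: cell_of_def)

lemma convex_cell_of: "convex (cell_of X K)"
proof -
  have "convex {x. x \<bullet> u \<le> t}" for u :: 'a and t
    using convex_halfspace_le[of u t] by (simp add: inner_commute)
  then show ?thesis
    unfolding cell_of_def by (intro convex_Inter) (auto simp: closed_halfspace_bounded_by_def)
qed

lemma cell_of_subset_halfspace:
  assumes "hyperplane v t \<in> X" "norm v = 1" "\<And>y. y \<in> K \<Longrightarrow> y \<bullet> v < t"
  shows "cell_of X K \<subseteq> {y. y \<bullet> v \<le> t}"
proof -
  have "hyperplane v t \<inter> K = {}" using assms(3) by (force simp: hyperplane_def)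
  moreover have "closed_halfspace_bounded_by (hyperplane v t) {y. y \<bullet> v \<le> t}"
    using assms(2) by (auto simp: closed_halfspace_bounded_by_def)
  moreover have "K \<subseteq> {y. y \<bullet> v \<le> t}" using assms(3) by (auto intro: less_imp_le)
  ultimately show ?thesis
    unfolding cell_of_def using assms(1) by blast
qed

lemma normal_hull_subset_cell_of:
  assumes C: "\<And>u t. norm u = 1 \<Longrightarrow> hyperplane u t \<in> X \<Longrightarrow> u \<in> C" and "compact K" "K \<noteq> {}"
  shows "normal_hull K C \<subseteq> cell_of X K"
proof
  fix x assume x: "x \<in> normal_hull K C"
  show "x \<in> cell_of X K"
    unfolding cell_of_def
  proof (intro InterI, clarify)
    fix h H assume H: "H \<in> X" "closed_halfspace_bounded_by H h" "K \<subseteq> h"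
    then obtain u t where u: "norm u = 1" "H = hyperplane u t" "h = {x. x \<bullet> u \<le> t}"
      by (auto simp: closed_halfspace_bounded_by_def)
    then have "u \<in> C" using C H(1) by blast
    then obtain y where "y \<in> K" "x \<bullet> u \<le> y \<bullet> u"
      using x unfolding normal_hull_def by blast
    then show "x \<in> h" using u H(3) by force
  qed
qed

text \<open>A segment from \<open>K\<close> to a farther point stays in \<open>Z\<close> and, by the
  intermediate value theorem, crosses the level set.\<close>

lemma convex_superset_within_infdist:
  fixes K Z :: "'a::euclidean_space set"
  assumes "K \<noteq> {}" "K \<subseteq> Z" "convex Z" and avoid: "Z \<inter> {x. infdist x K = \<epsilon>} = {}" and "\<epsilon> > 0"
    and z: "z \<in> Z"
  shows "infdist z K \<le> \<epsilon>"
proof (rule ccontr)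
  assume "\<not> infdist z K \<le> \<epsilon>"
  obtain k where k: "k \<in> K" using assms(1) by blast
  have "connected ((\<lambda>x. infdist x K) ` closed_segment k z)"
    by (intro connected_continuous_image continuous_intros) auto
  moreover have "infdist k K \<in> (\<lambda>x. infdist x K) ` closed_segment k z" "infdist z K \<in> (\<lambda>x. infdist x K) ` closed_segment k z"
    by auto
  moreover have "infdist k K \<le> \<epsilon>" "\<epsilon> \<le> infdist z K"
    using k \<open>\<epsilon> > 0\<close> \<open>\<not> infdist z K \<le> \<epsilon>\<close> by auto
  ultimately have "\<epsilon> \<in> (\<lambda>x. infdist x K) ` closed_segment k z"
    by (rule connectedD_interval)
  moreover have "closed_segment k z \<subseteq> Z"
    using k assms(2,3) z by (intro closed_segment_subset) auto
  ultimately show False using avoid by auto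
qed

lemma hausdorff_dist_superset_le:
  assumes "K \<subseteq> Z" "\<And>z. z \<in> Z \<Longrightarrow> infdist z K \<le> \<epsilon>"
  shows "hausdorff_dist K Z \<le> ennreal \<epsilon>"
  unfolding hausdorff_dist_def
proof (intro max.boundedI SUP_least)
  fix x assume "x \<in> K"
  then show "ennreal (infdist x Z) \<le> ennreal \<epsilon>" using assms(1) by (simp add: infdist_zero subset_iff)
qed (use assms(2) in \<open>simp add: ennreal_leI\<close>)

section \<open>Almost sure limits of the K-cells\<close>

context
  fixes \<phi> :: "'a::euclidean_space measure" and M :: "'w measure"
    and \<xi> :: "'w \<Rightarrow> (real \<times> 'a set) measure"
  assumes \<phi>: "directional_distribution \<phi>" and M: "prob_space M"
    and \<xi>: "hyperplane_driving_process M \<phi> \<xi>"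
begin

interpretation prob_space M by (rule M)

text \<open>Some direction in supp \<open>\<phi>\<close> separates \<open>x\<close> from
  \<open>K\<close>, so the hyperplanes near a separating one have positive finite measure. Once the
  process has hit them it does so for all larger \<open>\<gamma>\<close>. The radius is chosen
  before \<open>\<omega>\<close>, as the covering argument that follows requires.\<close>

lemma AE_K_cell_avoids_ball:
  assumes K: "compact K" "K \<noteq> {}"
    and x: "x \<notin> normal_hull K (support (top_of_set (sphere 0 1)) (emeasure \<phi>))"
  shows "\<exists>\<eta>>0. AE \<omega> in M. \<forall>\<^sub>F \<gamma> in at_top. K_cell \<xi> K \<gamma> \<omega> \<inter> ball x \<eta> = {}"
proof -
  obtain u where u: "u \<in> support (top_of_set (sphere 0 1)) (emeasure \<phi>)" "\<And>y. y \<in> K \<Longrightarrow> y \<bullet> u < x \<bullet> u"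
    using x by (auto simp: normal_hull_def not_le)
  obtain U a b \<eta> where U: "open U" "u \<in> U" "a < b" "\<eta> > 0"
    and below: "\<And>v t y. v \<in> U \<Longrightarrow> norm v = 1 \<Longrightarrow> a < t \<Longrightarrow> y \<in> K \<Longrightarrow> y \<bullet> v < t"
    and above: "\<And>v t y. v \<in> U \<Longrightarrow> norm v = 1 \<Longrightarrow> t < b \<Longrightarrow> y \<in> ball x \<eta> \<Longrightarrow> t < y \<bullet> v"
    using strictly_separating_hyperplanes[OF K u(2)] by metis
  have pos: "emeasure \<phi> (sphere 0 1 \<inter> U) > 0"
    using u(1) U(2) openin_open_Int[OF U(1), of "sphere 0 1"] by (auto simp: support_def)
  define B where "B = hyperplanes_of (U \<times> {a<..<b})"
  have oB: "openin hyperplane_topology B"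
    unfolding B_def using U by (intro openin_hyperplanes_of open_Times) auto
  have B: "B \<in> sets hyperplane_borel" by (rule openin_hyperplane_topology_sets[OF oB])
  have "emeasure (hyperplane_measure \<phi> 1) B < \<infinity>"
    unfolding B_def using U
    by (intro emeasure_hyperplane_measure_finite[OF \<phi>, where c = "max \<bar>a\<bar> \<bar>b\<bar>"] open_Times) auto
  moreover have "emeasure (hyperplane_measure \<phi> 1) B > 0"
    unfolding B_def using \<phi> U(1) pos U(3) by (rule emeasure_hyperplane_measure_pos)
  ultimately have "AE \<omega> in M. \<exists>n::nat. emeasure (\<xi> \<omega>) ({0..real n} \<times> B) > 0"
    by (rule AE_driving_process_hits[OF \<phi> M \<xi> B])
  then have "AE \<omega> in M. \<forall>\<^sub>F \<gamma> in at_top. K_cell \<xi> K \<gamma> \<omega> \<inter> ball x \<eta> = {}"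
    using AE_space
  proof eventually_elim
    case (elim \<omega>)
    then obtain n :: nat where n: "emeasure (\<xi> \<omega>) ({0..real n} \<times> B) > 0" by blast
    show ?case
      using eventually_ge_at_top[of "real n"]
    proof eventually_elim
      fix \<gamma> assume "real n \<le> \<gamma>"
      then have "emeasure (\<xi> \<omega>) ({0..real n} \<times> B) \<le> emeasure (\<xi> \<omega>) ({0..\<gamma>} \<times> B)"
        using sets_driving_process[OF \<phi> M \<xi> elim(2) oB] by (intro emeasure_mono) auto
      then have "emeasure (\<xi> \<omega>) ({0..\<gamma>} \<times> B) > 0" using n by simp
      then obtain H where H: "H \<in> B" "H \<in> support hyperplane_topology (hyperplane_process \<xi> \<gamma> \<omega>)"
        using support_hyperplane_process_meets[OF _ oB, of \<gamma> \<xi> \<omega>] sets_driving_process[OF \<phi> M \<xi> elim(2)]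
        by blast
      then obtain v t where v: "H = hyperplane v t" "norm v = 1" "v \<in> U" "a < t" "t < b"
        by (auto simp: B_def hyperplanes_of_def)
      have "K_cell \<xi> K \<gamma> \<omega> \<subseteq> {y. y \<bullet> v \<le> t}"
        unfolding K_cell_def using H v below by (intro cell_of_subset_halfspace) auto
      then show "K_cell \<xi> K \<gamma> \<omega> \<inter> ball x \<eta> = {}"
        using above[OF v(3,2,5)] by (force simp: not_less)
    qed
  qed
  then show ?thesis using U(4) by blast
qed

text \<open>The level set \<open>F\<close> is compact and disjoint from \<open>K\<close>, so
  finitely many of the avoided balls cover it and finitely many almost sure events are
  combined.\<close>

lemma AE_hausdorff_dist_K_cell_le:
  assumes K: "convex_body K"
    and hull: "normal_hull K (support (top_of_set (sphere 0 1)) (emeasure \<phi>)) = K" and "\<epsilon> > 0"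
  shows "AE \<omega> in M. \<forall>\<^sub>F \<gamma> in at_top. hausdorff_dist K (K_cell \<xi> K \<gamma> \<omega>) \<le> ennreal \<epsilon>"
proof -
  have cK: "compact K" and neK: "K \<noteq> {}" using K by (auto simp: convex_body_def)
  define F where "F = {x. infdist x K = \<epsilon>}"
  have "compact F"
  proof -
    have "F = (\<lambda>x. infdist x K) -` {\<epsilon>}" by (auto simp: F_def)
    then have "closed F" by (auto intro!: closed_vimage continuous_intros)
    moreover have "bounded F"
      using compact_infdist_le[OF neK cK \<open>\<epsilon> > 0\<close>] by (rule bounded_subset[OF compact_imp_bounded]) (auto simp: F_def)
    ultimately show ?thesis by (simp add: compact_eq_bounded_closed)
  qed
  have "x \<notin> normal_hull K (support (top_of_set (sphere 0 1)) (emeasure \<phi>))" if "x \<in> F" for x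
    using that \<open>\<epsilon> > 0\<close> by (auto simp: hull F_def)
  then have "\<exists>\<eta>>0. AE \<omega> in M. \<forall>\<^sub>F \<gamma> in at_top. K_cell \<xi> K \<gamma> \<omega> \<inter> ball x \<eta> = {}" if "x \<in> F" for x
    using AE_K_cell_avoids_ball[OF cK neK] that by blast
  then obtain \<eta> where \<eta>: "\<And>x. x \<in> F \<Longrightarrow> \<eta> x > 0"
    "\<And>x. x \<in> F \<Longrightarrow> AE \<omega> in M. \<forall>\<^sub>F \<gamma> in at_top. K_cell \<xi> K \<gamma> \<omega> \<inter> ball x (\<eta> x) = {}"
    by metis
  have "F \<subseteq> (\<Union>x\<in>F. ball x (\<eta> x))" using \<eta>(1) by force
  then obtain D where D: "D \<subseteq> F" "finite D" "F \<subseteq> (\<Union>x\<in>D. ball x (\<eta> x))"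
    using compactE_image[OF \<open>compact F\<close>, of F "\<lambda>x. ball x (\<eta> x)"] by auto
  have "AE \<omega> in M. \<forall>x\<in>D. \<forall>\<^sub>F \<gamma> in at_top. K_cell \<xi> K \<gamma> \<omega> \<inter> ball x (\<eta> x) = {}"
    using D(1) \<eta>(2) by (intro AE_finite_allI D(2)) auto
  then show ?thesis
  proof eventually_elim
    case (elim \<omega>)
    then have "\<forall>\<^sub>F \<gamma> in at_top. \<forall>x\<in>D. K_cell \<xi> K \<gamma> \<omega> \<inter> ball x (\<eta> x) = {}"
      by (rule eventually_ball_finite[OF D(2)])
    then show ?case
    proof eventually_elim
      case (elim \<gamma>)
      then have avoid: "K_cell \<xi> K \<gamma> \<omega> \<inter> {x. infdist x K = \<epsilon>} = {}"
        using D(3) unfolding F_def by blast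
      have "K \<subseteq> K_cell \<xi> K \<gamma> \<omega>" "convex (K_cell \<xi> K \<gamma> \<omega>)"
        unfolding K_cell_def by (rule subset_cell_of convex_cell_of)+
      then show ?case
        using convex_superset_within_infdist[OF neK _ _ avoid \<open>\<epsilon> > 0\<close>]
        by (intro hausdorff_dist_superset_le) auto
    qed
  qed
qed

lemma AE_K_cell_tendsto:
  assumes K: "convex_body K"
    and hull: "normal_hull K (support (top_of_set (sphere 0 1)) (emeasure \<phi>)) = K"
  shows "AE \<omega> in M. ((\<lambda>\<gamma>. hausdorff_dist K (K_cell \<xi> K \<gamma> \<omega>)) \<longlongrightarrow> 0) at_top"
proof -
  have "AE \<omega> in M. \<forall>n. \<forall>\<^sub>F \<gamma> in at_top. hausdorff_dist K (K_cell \<xi> K \<gamma> \<omega>) \<le> ennreal (inverse (real (Suc n)))"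
    unfolding AE_all_countable using AE_hausdorff_dist_K_cell_le[OF assms] by simp
  then show ?thesis
  proof eventually_elim
    case (elim \<omega>)
    show ?case
    proof (rule order_tendstoI)
      fix a :: ennreal assume "0 < a"
      then obtain e where e: "e > 0" "ennreal e < a" by (rule ennreal_pos_real_below)
      obtain n where "inverse (real (Suc n)) < e" using reals_Archimedean e by blast
      then have n: "ennreal (inverse (real (Suc n))) < a" using e by (meson ennreal_leI less_imp_le order_le_less_trans)
      show "\<forall>\<^sub>F \<gamma> in at_top. hausdorff_dist K (K_cell \<xi> K \<gamma> \<omega>) < a"
        using spec[OF elim, of n] by (rule eventually_mono) (use n in simp)
    qed simp
  qed
qed

text \<open>Almost surely no hyperplane of the process has a normal in \<open>U\<close>, so every
  halfspace forming the cell has its outer normal in the complement and contains the hull.\<close>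

lemma AE_normal_hull_subset_K_cell:
  assumes K: "compact K" "K \<noteq> {}" and U: "openin (top_of_set (sphere 0 1)) U" and null: "emeasure \<phi> U = 0"
  shows "AE \<omega> in M. \<forall>\<gamma>. normal_hull K (sphere 0 1 - U) \<subseteq> K_cell \<xi> K \<gamma> \<omega>"
proof -
  obtain V where V: "open V" "U = sphere 0 1 \<inter> V" using U by (auto simp: openin_open)
  define B where "B = hyperplanes_of (V \<times> UNIV)"
  have oB: "openin hyperplane_topology B"
    unfolding B_def using V by (intro openin_hyperplanes_of open_Times) auto
  have B: "B \<in> sets hyperplane_borel" by (rule openin_hyperplane_topology_sets[OF oB])
  have "emeasure (hyperplane_measure \<phi> 1) B = 0"
    unfolding B_def using emeasure_hyperplane_measure_null_directions[OF \<phi> V(1)] null V(2) by simp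
  then have "AE \<omega> in M. \<forall>n::nat. emeasure (\<xi> \<omega>) ({0..real n} \<times> B) = 0"
    by (rule AE_driving_process_avoids[OF \<phi> M \<xi> B])
  then show ?thesis
    using AE_space
  proof eventually_elim
    case (elim \<omega>)
    show ?case
    proof
      fix \<gamma> :: real
      \<comment> \<open>Comparison with an integer lets a single null event serve all real
        \<open>\<gamma>\<close>.\<close>
      obtain n :: nat where "\<gamma> \<le> real n" using real_arch_simple by blast
      then have "emeasure (\<xi> \<omega>) ({0..\<gamma>} \<times> B) \<le> emeasure (\<xi> \<omega>) ({0..real n} \<times> B)"
        using sets_driving_process[OF \<phi> M \<xi> elim(2) oB] by (intro emeasure_mono) auto
      then have "emeasure (\<xi> \<omega>) ({0..\<gamma>} \<times> B) = 0" using elim(1) by simp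
      then have "support hyperplane_topology (hyperplane_process \<xi> \<gamma> \<omega>) \<inter> B = {}"
        by (rule support_hyperplane_process_avoids[OF oB])
      then have "u \<in> sphere 0 1 - U"
        if "norm u = 1" "hyperplane u t \<in> support hyperplane_topology (hyperplane_process \<xi> \<gamma> \<omega>)" for u t
        using that hyperplanes_ofI[of u t "V \<times> UNIV"] V(2) unfolding B_def by auto
      then show "normal_hull K (sphere 0 1 - U) \<subseteq> K_cell \<xi> K \<gamma> \<omega>"
        unfolding K_cell_def by (intro normal_hull_subset_cell_of K) auto
    qed
  qed
qed

end

text \<open>The distance from a fixed point of \<open>P\<close> to \<open>K\<close> is bounded by a
  quantity tending to 0, hence is 0, and \<open>K\<close> is closed.\<close>

lemma subset_closed_of_hausdorff_dist_tendsto_0: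
  assumes "closed K" "K \<noteq> {}" and P: "\<And>\<gamma>. P \<subseteq> Z \<gamma>"
    and lim: "((\<lambda>\<gamma>. hausdorff_dist K (Z \<gamma>)) \<longlongrightarrow> 0) F" and "F \<noteq> bot"
  shows "P \<subseteq> K"
proof
  fix y assume "y \<in> P"
  have "ennreal (infdist y K) \<le> hausdorff_dist K (Z \<gamma>)" for \<gamma>
    unfolding hausdorff_dist_def using P \<open>y \<in> P\<close> by (intro max.coboundedI2 SUP_upper) auto
  then have "ennreal (infdist y K) \<le> 0"
    using lim \<open>F \<noteq> bot\<close> by (intro tendsto_lowerbound[OF lim]) auto
  then have "infdist y K = 0" using infdist_nonneg[of y K] by (simp add: ennreal_eq_0_iff)
  then show "y \<in> K" using assms(1,2) in_closed_iff_infdist_zero by blast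
qed

theorem mainTheorem2:
  fixes \<phi> :: "'a::euclidean_space measure"
    and K :: "'a set"
    and M :: "'w measure"
    and \<xi> :: "'w \<Rightarrow> (real \<times> 'a set) measure"
  assumes "DIM('a) \<ge> 2"
    and "directional_distribution \<phi>"
    and "convex_body K"
    and "prob_space M"
    and "hyperplane_driving_process M \<phi> \<xi>"
  shows "support (top_of_set (sphere 0 1)) (surface_area_measure K)
           \<subseteq> support (top_of_set (sphere 0 1)) (emeasure \<phi>)
         \<longleftrightarrow> (AE \<omega> in M. ((\<lambda>\<gamma>. hausdorff_dist K (K_cell \<xi> K \<gamma> \<omega>)) \<longlongrightarrow> 0) at_top)"
proof
  assume "support (top_of_set (sphere 0 1)) (surface_area_measure K)
           \<subseteq> support (top_of_set (sphere 0 1)) (emeasure \<phi>)"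
  then have "normal_hull K (support (top_of_set (sphere 0 1)) (emeasure \<phi>)) \<subseteq>
      normal_hull K (support (top_of_set (sphere 0 1)) (surface_area_measure K))"
    by (auto simp: normal_hull_def)
  then have "normal_hull K (support (top_of_set (sphere 0 1)) (emeasure \<phi>)) = K"
    using normal_hull_support_surface_area_measure[OF assms(3,1)] subset_normal_hull by blast
  then show "AE \<omega> in M. ((\<lambda>\<gamma>. hausdorff_dist K (K_cell \<xi> K \<gamma> \<omega>)) \<longlongrightarrow> 0) at_top"
    using assms by (intro AE_K_cell_tendsto)
next
  interpret prob_space M by fact
  assume conv: "AE \<omega> in M. ((\<lambda>\<gamma>. hausdorff_dist K (K_cell \<xi> K \<gamma> \<omega>)) \<longlongrightarrow> 0) at_top"
  have K: "compact K" "closed K" "K \<noteq> {}"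
    using assms(3) by (auto simp: convex_body_def compact_imp_closed)
  show "support (top_of_set (sphere 0 1)) (surface_area_measure K)
           \<subseteq> support (top_of_set (sphere 0 1)) (emeasure \<phi>)"
  proof (rule subsetI, rule ccontr)
    fix u assume u: "u \<in> support (top_of_set (sphere 0 1)) (surface_area_measure K)"
      and "u \<notin> support (top_of_set (sphere 0 1)) (emeasure \<phi>)"
    then obtain U where U: "openin (top_of_set (sphere 0 1)) U" "u \<in> U" "emeasure \<phi> U = 0"
      by (auto simp: support_def)
    have "AE \<omega> in M. normal_hull K (sphere 0 1 - U) \<subseteq> K"
      using conv AE_normal_hull_subset_K_cell[OF assms(2,4,5) K(1,3) U(1,3)]
    proof eventually_elim
      case (elim \<omega>)
      then show ?case
        by (intro subset_closed_of_hausdorff_dist_tendsto_0[OF K(2,3) _ elim(1)]) auto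
    qed
    \<comment> \<open>The inclusion does not involve \<open>\<omega>\<close>, so in a probability
      space its almost sure validity is plain validity.\<close>
    then have "normal_hull K (sphere 0 1 - U) = K"
      using subset_normal_hull by auto
    then have "surface_area_measure K U = 0"
      by (rule surface_area_measure_0_of_normal_hull[OF assms(3) U(1)])
    then show False using u U(1,2) by (auto simp: support_def)
  qed
qed

end
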